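(* Let $\mathcal{J}$ be a Hilbert space and let $\mathscr{M}$ be a Hilbert space that is a linear subspace of $\mathbb{H}^2_d\otimes\mathcal{J}$. Then $\mathscr{M}$ is boundedly contained in $\mathbb{H}^2_d\otimes\mathcal{J}$, is $(R\otimes I_{\mathcal{J}})$-invariant, and $X:=(R\otimes I_{\mathcal{J}})|_{\mathscr{M}}$ is a row contraction (for the norm of $\mathscr{M}$), if and only if there exist a Hilbert space $\mathcal{F}$ and a bounded operator-valued left multiplier $F\in\mathbb{H}^\infty_d\otimes\mathcal{L}(\mathcal{F},\mathcal{J})$ such that $\mathscr{M}=\mathscr{M}^L(F)$ and $\|F(L)\|=\|\mathrm{e}\|$, where $\mathrm{e}:\mathscr{M}\hookrightarrow\mathbb{H}^2_d\otimes\mathcal{J}$ is the bounded embedding.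
   Context: Let $d\in\mathbb{N}$ and let $\mathbb{F}^d$ be the set of all words (including the empty word) in the letters $1,\dots,d$. The NC Hardy space (full Fock space) $\mathbb{H}^2_d$ is the Hilbert space of formal power series $f=\sum_{\alpha\in\mathbb{F}^d}\hat f_\alpha\mathfrak{z}^\alpha$ in $d$ non-commuting variables with square-summable coefficients, with the $\ell^2$ inner product of coefficients. $L_k$ and $R_k$ are the isometries of left, respectively right, multiplication by $\mathfrak{z}_k$; $R=(R_1,\dots,R_d)$. For Hilbert spaces $\mathcal{F},\mathcal{J}$, $\mathbb{H}^\infty_d\otimes\mathcal{L}(\mathcal{F},\mathcal{J})$ (weak-$*$ closed tensor product) is the space of operator-valued left multipliers: equivalently the bounded operators $F=F(L):\mathbb{H}^2_d\otimes\mathcal{F}\to\mathbb{H}^2_d\otimes\mathcal{J}$ with $F(L)(R_k\otimes I_{\mathcal{F}})=(R_k\otimes I_{\mathcal{J}})F(L)$ for all $k$. The operator range space $\mathscr{M}^L(F)$ is the vector space $\mathrm{Ran}(F(L))\subseteq\mathbb{H}^2_d\otimes\mathcal{J}$ with norm $\|F(L)x\|_F:=\|P_{\mathrm{Ker}(F(L))^\perp}x\|$. An equality $\mathscr{M}=\mathscr{M}^L(F)$ means equality as Hilbert spaces (same vectors, same norm). A Hilbert space $\mathscr{M}\subseteq\mathbb{H}^2_d\otimes\mathcal{J}$ is boundedly contained if the inclusion $\mathrm{e}$ is bounded. $(R\otimes I_{\mathcal{J}})$-invariant means $(R_k\otimes I_{\mathcal{J}})\mathscr{M}\subseteq\mathscr{M}$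 for all $k$; $(R\otimes I_{\mathcal{J}})|_{\mathscr{M}}$ is the row $(X_1,\dots,X_d):\mathscr{M}\otimes\mathbb{C}^d\to\mathscr{M}$ with $X_k=(R_k\otimes I_{\mathcal{J}})|_{\mathscr{M}}$. A row contraction is a $d$-tuple $(T_1,\dots,T_d)$ of operators on a Hilbert space $\mathcal{H}$ such that the row operator $\mathcal{H}\otimes\mathbb{C}^d\to\mathcal{H}$ is a contraction. *)

theory Defs
  imports "HOL-Analysis.Analysis" "HOL-Library.Function_Algebras"
begin

section \<open>Complex Hilbert spaces\<close>

class complex_vector = ab_group_add +
  fixes scaleC :: "complex \<Rightarrow> 'a \<Rightarrow> 'a" (infixr "*\<^sub>C" 75)
  assumes scaleC_add_right: "a *\<^sub>C (x + y) = a *\<^sub>C x + a *\<^sub>C y"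
    and scaleC_add_left: "(a + b) *\<^sub>C x = a *\<^sub>C x + b *\<^sub>C x"
    and scaleC_scaleC: "a *\<^sub>C (b *\<^sub>C x) = (a * b) *\<^sub>C x"
    and scaleC_one: "1 *\<^sub>C x = x"

global_interpretation cvec: vector_space "scaleC :: complex \<Rightarrow> 'a \<Rightarrow> 'a :: complex_vector"
  by unfold_locales (simp_all add: scaleC_add_right scaleC_add_left scaleC_scaleC scaleC_one)

instantiation complex :: complex_vector
begin
definition "scaleC (a :: complex) (x :: complex) = a * x"
instance by standard (simp_all add: scaleC_complex_def algebra_simps)
end

instantiation "fun" :: (type, complex_vector) complex_vector
begin
definition "scaleC a f = (\<lambda>x. a *\<^sub>C f x)"
instance
  by standard (simp_all add: scaleC_fun_def fun_eq_iff scaleC_add_right scaleC_add_left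
      scaleC_scaleC scaleC_one)
end

text \<open>
  A Hilbert space is given by a carrier, which is a linear subspace of some ambient complex vector
  space, and an inner product which is only relevant on the carrier. Thus one linear subspace
  of a Hilbert space can carry a Hilbert space structure of its own, and one can quantify over
  Hilbert spaces inside a formula. Inner products are conjugate linear in the first argument.
\<close>

record 'a hilb =
  carr :: "'a set"
  ip :: "'a \<Rightarrow> 'a \<Rightarrow> complex"

definition hnorm :: "'a hilb \<Rightarrow> 'a \<Rightarrow> real" where
  "hnorm H x = sqrt (Re (ip H x x))"

locale hilbert_space =
  fixes H :: "'a :: complex_vector hilb"
  assumes subspace_carr: "cvec.subspace (carr H)"
    and ip_add_right: "\<lbrakk>x \<in> carr H; y \<in> carr H; z \<in> carr H\<rbrakk> \<Longrightarrow> ip H x (y + z) = ip H x y + ip H x z"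
    and ip_scale_right: "\<lbrakk>x \<in> carr H; y \<in> carr H\<rbrakk> \<Longrightarrow> ip H x (c *\<^sub>C y) = c * ip H x y"
    and ip_commute: "\<lbrakk>x \<in> carr H; y \<in> carr H\<rbrakk> \<Longrightarrow> ip H y x = cnj (ip H x y)"
    and ip_nonneg: "x \<in> carr H \<Longrightarrow> 0 \<le> Re (ip H x x)"
    and ip_definite: "\<lbrakk>x \<in> carr H; ip H x x = 0\<rbrakk> \<Longrightarrow> x = 0"
    and complete: "\<lbrakk>\<forall>n. s n \<in> carr H;
        \<forall>e>0. \<exists>N. \<forall>m\<ge>N. \<forall>n\<ge>N. hnorm H (s m - s n) < e\<rbrakk>
      \<Longrightarrow> \<exists>l\<in>carr H. (\<lambda>n. hnorm H (s n - l)) \<longlonglongrightarrow> 0"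

definition bounded_op ::
    "'a :: complex_vector hilb \<Rightarrow> 'b :: complex_vector hilb \<Rightarrow> ('a \<Rightarrow> 'b) \<Rightarrow> bool" where
  "bounded_op H K T \<longleftrightarrow>
     (\<forall>x\<in>carr H. T x \<in> carr K) \<and>
     (\<forall>x\<in>carr H. \<forall>y\<in>carr H. T (x + y) = T x + T y) \<and>
     (\<forall>c. \<forall>x\<in>carr H. T (c *\<^sub>C x) = c *\<^sub>C T x) \<and>
     (\<exists>C. \<forall>x\<in>carr H. hnorm K (T x) \<le> C * hnorm H x)"

definition opnorm ::
    "'a :: complex_vector hilb \<Rightarrow> 'b :: complex_vector hilb \<Rightarrow> ('a \<Rightarrow> 'b) \<Rightarrow> real" where
  "opnorm H K T = (SUP x \<in> {x \<in> carr H. hnorm H x \<le> 1}. hnorm K (T x))"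

definition ker_op :: "'a :: complex_vector hilb \<Rightarrow> ('a \<Rightarrow> 'b :: complex_vector) \<Rightarrow> 'a set" where
  "ker_op H T = {x \<in> carr H. T x = 0}"

definition ortho :: "'a :: complex_vector hilb \<Rightarrow> 'a set \<Rightarrow> 'a set" where
  "ortho H S = {x \<in> carr H. \<forall>y\<in>S. ip H y x = 0}"

text \<open>Orthogonal projection onto \<open>S\<close>; meaningful when \<open>S\<close> is a closed subspace of \<open>H\<close>.\<close>
definition proj :: "'a :: complex_vector hilb \<Rightarrow> 'a set \<Rightarrow> 'a \<Rightarrow> 'a" where
  "proj H S x = (THE p. p \<in> S \<and> x - p \<in> ortho H S)"

text \<open>
  \<open>M\<close> is the operator range space of \<open>T : H \<rightarrow> K\<close>: the vector space \<open>Ran T\<close> with the norm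
  \<open>\<parallel>T x\<parallel> = \<parallel>P x\<parallel>\<close>, where \<open>P\<close> projects onto the orthogonal complement of \<open>Ker T\<close>. By polarization,
  equality of norms of Hilbert spaces on the same vector space is equality of inner products.
\<close>
definition is_operator_range ::
    "'b :: complex_vector hilb \<Rightarrow> 'a :: complex_vector hilb \<Rightarrow> ('a \<Rightarrow> 'b) \<Rightarrow> bool" where
  "is_operator_range M H T \<longleftrightarrow>
     carr M = T ` carr H \<and>
     (\<forall>x\<in>carr H. hnorm M (T x) = hnorm H (proj H (ortho H (ker_op H T)) x))"

text \<open>\<open>direct_sum H\<close> is \<open>H \<otimes> \<complex>\<^sup>d\<close>, that is, \<open>d\<close>-tuples of vectors of \<open>H\<close> where \<open>d = CARD('d)\<close>.\<close>
definition direct_sum :: "'a hilb \<Rightarrow> ('d :: finite \<Rightarrow> 'a) hilb" where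
  "direct_sum H = \<lparr>carr = {x. \<forall>k. x k \<in> carr H}, ip = (\<lambda>x y. \<Sum>k\<in>UNIV. ip H (x k) (y k))\<rparr>"

definition row_op :: "('d :: finite \<Rightarrow> 'a \<Rightarrow> 'a :: complex_vector) \<Rightarrow> ('d \<Rightarrow> 'a) \<Rightarrow> 'a" where
  "row_op T x = (\<Sum>k\<in>UNIV. T k (x k))"

definition row_contraction ::
    "'a :: complex_vector hilb \<Rightarrow> ('d :: finite \<Rightarrow> 'a \<Rightarrow> 'a) \<Rightarrow> bool" where
  "row_contraction H T \<longleftrightarrow>
     (\<forall>k. bounded_op H H (T k)) \<and>
     (\<forall>x\<in>carr (direct_sum H). hnorm H (row_op T x) \<le> hnorm (direct_sum H) x)"

section \<open>The full Fock space and its multipliers\<close>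

text \<open>
  The letters are the elements of a finite type \<open>'d\<close> with \<open>d = CARD('d)\<close>, and words are lists of
  letters. \<open>fock J\<close> is the Hilbert space tensor product of the full Fock space with \<open>J\<close>, realized
  in the usual way as the space of formal power series with square-summable coefficients in \<open>J\<close>:
  \<open>f\<close> stands for the series with coefficient \<open>f \<alpha>\<close> at the monomial of the word \<open>\<alpha>\<close>, and the
  elementary tensor of a scalar series \<open>h\<close> and a vector \<open>x\<close> is \<open>etensor h x\<close>.
\<close>

definition fock :: "'j hilb \<Rightarrow> ('d :: finite list \<Rightarrow> 'j) hilb" where
  "fock J =
     \<lparr>carr = {f. (\<forall>\<alpha>. f \<alpha> \<in> carr J) \<and> (\<lambda>\<alpha>. (hnorm J (f \<alpha>))\<^sup>2) summable_on UNIV},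
      ip = (\<lambda>f g. \<Sum>\<^sub>\<infinity>\<alpha>. ip J (f \<alpha>) (g \<alpha>))\<rparr>"

text \<open>Right multiplication by the variable \<open>k\<close>, tensored with the identity of \<open>J\<close>: it moves the
  coefficient at the word \<open>\<alpha>\<close> to the word \<open>\<alpha> @ [k]\<close>.\<close>
definition R :: "'d :: finite \<Rightarrow> ('d list \<Rightarrow> 'j :: complex_vector) \<Rightarrow> 'd list \<Rightarrow> 'j" where
  "R k f = (\<lambda>\<beta>. if \<beta> \<noteq> [] \<and> last \<beta> = k then f (butlast \<beta>) else 0)"

lemma R_append: "R k f (\<alpha> @ [j]) = (if j = k then f \<alpha> else 0)"
  and R_Nil: "R k f [] = 0"
  by (simp_all add: R_def)

definition complex_hilb :: "complex hilb" where
  "complex_hilb = \<lparr>carr = UNIV, ip = (\<lambda>a b. cnj a * b)\<rparr>"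

definition etensor :: "('d list \<Rightarrow> complex) \<Rightarrow> 'j :: complex_vector \<Rightarrow> 'd list \<Rightarrow> 'j" where
  "etensor h x = (\<lambda>\<alpha>. h \<alpha> *\<^sub>C x)"

lemma ip_fock_etensor:
  fixes h g :: "'d :: finite list \<Rightarrow> complex"
  assumes "hilbert_space J" "x \<in> carr J" "y \<in> carr J"
  shows "ip (fock J) (etensor h x) (etensor g y) = ip (fock complex_hilb) h g * ip J x y"
proof -
  interpret hilbert_space J by fact
  have sc: "c *\<^sub>C z \<in> carr J" if "z \<in> carr J" for c z
    using subspace_carr that by (rule cvec.subspace_scale)
  have "ip J (a *\<^sub>C x) (b *\<^sub>C y) = cnj a * b * ip J x y" for a b
    using assms sc ip_scale_right[of "a *\<^sub>C x" y b] ip_commute[of "y" "a *\<^sub>C x"]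
      ip_scale_right[of y x a] ip_commute[of y x] by simp
  then show ?thesis
    by (simp add: fock_def complex_hilb_def etensor_def infsum_cmult_left')
qed

lemma R_etensor: "R k (etensor h x) = etensor (R k h) x"
  by (auto simp: R_def etensor_def fun_eq_iff)

text \<open>\<open>T\<close> is \<open>F(L)\<close> for a bounded left multiplier with coefficients operators from \<open>F\<close> to \<open>J\<close>.\<close>
definition left_multiplier ::
    "'f :: complex_vector hilb \<Rightarrow> 'j :: complex_vector hilb \<Rightarrow>
      (('d :: finite list \<Rightarrow> 'f) \<Rightarrow> ('d list \<Rightarrow> 'j)) \<Rightarrow> bool" where
  "left_multiplier F J T \<longleftrightarrow>
     bounded_op (fock F) (fock J) T \<and> (\<forall>k. \<forall>f\<in>carr (fock F). T (R k f) = R k (T f))"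

text \<open>The norm of the embedding of \<open>M\<close> is the norm of the identity as an operator from \<open>M\<close> to
  \<open>fock J\<close>.\<close>
definition realizes ::
    "'j :: complex_vector hilb \<Rightarrow> ('d :: finite list \<Rightarrow> 'j) hilb \<Rightarrow> 'f :: complex_vector hilb \<Rightarrow>
      (('d list \<Rightarrow> 'f) \<Rightarrow> ('d list \<Rightarrow> 'j)) \<Rightarrow> bool" where
  "realizes J M F T \<longleftrightarrow>
     hilbert_space F \<and> left_multiplier F J T \<and> is_operator_range M (fock F) T \<and>
     opnorm (fock F) (fock J) T = opnorm M (fock J) (\<lambda>x. x)"

end

theory Submission
  imports Defs "HOL-Library.Countable_Set"
begin

text \<open>
  If \<open>M\<close> is the range of a multiplier \<open>T\<close>, lift vectors of \<open>M\<close> isometrically to the orthogonal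
  complement of \<open>Ker T\<close>; the row of right shifts on \<open>fock F\<close> is isometric, and \<open>T\<close> intertwines it with
  the row \<open>X\<close> of right shifts on \<open>M\<close>.

  Conversely, let \<open>X\<close> be a row contraction with defect operator \<open>\<Delta> = I - \<Sum> X\<^sub>k X\<^sub>k\<^sup>*\<close>, and factor
  \<open>\<Delta> = D\<^sup>* D\<close> with \<open>D : M \<rightarrow> F\<close>. The map \<open>V m = (D X\<^sup>*\<^sup>\<alpha> m)\<^sub>\<alpha>\<close> into \<open>fock F\<close> intertwines the adjoint shifts, and
  it is isometric because \<open>X\<close> is pure: \<open>X\<^sup>*\<^sup>\<alpha>\<close> kills the vectors representing the coefficient
  functionals of short words, and these vectors span a dense subspace. Then \<open>T = V\<^sup>*\<close>, seen as a map
  into \<open>fock J\<close>, is the required multiplier; it maps the unit ball of \<open>fock F\<close> onto that of \<open>M\<close>.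

  The factor \<open>D\<close> is found without functional calculus: setting \<open>A\<^sub>0 = \<Delta>\<close> and \<open>A\<^sub>n\<^sub>+\<^sub>1 = A\<^sub>n - A\<^sub>n\<^sup>2\<close>, the sum
  \<open>\<Sum> A\<^sub>n\<^sup>2\<close> telescopes to \<open>\<Delta>\<close>, so that \<open>D x = (A\<^sub>n x)\<^sub>n\<close> works.
\<close>

section \<open>Projections and the Riesz representation theorem\<close>

context hilbert_space
begin

section \<open>Algebra of inner products and norms on a carrier\<close>

lemma carr_closed [simp, intro]:
  shows zero_carr: "0 \<in> carr H"
    and add_carr: "\<lbrakk>x \<in> carr H; y \<in> carr H\<rbrakk> \<Longrightarrow> x + y \<in> carr H"
    and scale_carr: "x \<in> carr H \<Longrightarrow> c *\<^sub>C x \<in> carr H"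
    and diff_carr: "\<lbrakk>x \<in> carr H; y \<in> carr H\<rbrakk> \<Longrightarrow> x - y \<in> carr H"
  using subspace_carr
  by (auto intro: cvec.subspace_0 cvec.subspace_add cvec.subspace_scale cvec.subspace_diff)

lemma sum_carr [simp, intro]: "(\<And>i. i \<in> I \<Longrightarrow> f i \<in> carr H) \<Longrightarrow> sum f I \<in> carr H"
  using subspace_carr by (rule cvec.subspace_sum)

lemma ip_zero_right [simp]: "x \<in> carr H \<Longrightarrow> ip H x 0 = 0"
  using ip_scale_right[of x 0 0] by simp

lemma ip_diff_right:
  "\<lbrakk>x \<in> carr H; y \<in> carr H; z \<in> carr H\<rbrakk> \<Longrightarrow> ip H x (y - z) = ip H x y - ip H x z"
  using ip_add_right[of x "y - z" z] by simp

lemma ip_sum_right: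
  "\<lbrakk>x \<in> carr H; \<And>i. i \<in> I \<Longrightarrow> f i \<in> carr H\<rbrakk> \<Longrightarrow> ip H x (sum f I) = (\<Sum>i\<in>I. ip H x (f i))"
  by (induction I rule: infinite_finite_induct) (auto simp: ip_add_right)

lemma ip_zero_left [simp]: "x \<in> carr H \<Longrightarrow> ip H 0 x = 0"
  using ip_commute[of x 0] by simp

lemma ip_add_left:
  "\<lbrakk>x \<in> carr H; y \<in> carr H; z \<in> carr H\<rbrakk> \<Longrightarrow> ip H (x + y) z = ip H x z + ip H y z"
  using ip_commute[of z "x + y"] ip_commute[of z x] ip_commute[of z y] by (simp add: ip_add_right)

lemma ip_diff_left:
  "\<lbrakk>x \<in> carr H; y \<in> carr H; z \<in> carr H\<rbrakk> \<Longrightarrow> ip H (x - y) z = ip H x z - ip H y z"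
  using ip_add_left[of "x - y" y z] by simp

lemma ip_scale_left: "\<lbrakk>x \<in> carr H; y \<in> carr H\<rbrakk> \<Longrightarrow> ip H (c *\<^sub>C x) y = cnj c * ip H x y"
  using ip_commute[of y "c *\<^sub>C x"] ip_commute[of y x] by (simp add: ip_scale_right)

lemma ip_sum_left:
  "\<lbrakk>x \<in> carr H; \<And>i. i \<in> I \<Longrightarrow> f i \<in> carr H\<rbrakk> \<Longrightarrow> ip H (sum f I) x = (\<Sum>i\<in>I. ip H (f i) x)"
  by (induction I rule: infinite_finite_induct) (auto simp: ip_add_left)

lemma hnorm_nonneg [simp]: "x \<in> carr H \<Longrightarrow> 0 \<le> hnorm H x"
  by (simp add: hnorm_def ip_nonneg)

lemma hnorm_sq: "x \<in> carr H \<Longrightarrow> (hnorm H x)\<^sup>2 = Re (ip H x x)"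
  by (simp add: hnorm_def ip_nonneg)

lemma ip_self: "x \<in> carr H \<Longrightarrow> ip H x x = complex_of_real ((hnorm H x)\<^sup>2)"
  using ip_commute[of x x] by (simp add: complex_eq_iff hnorm_sq)

lemma hnorm_eq_0_iff: "x \<in> carr H \<Longrightarrow> hnorm H x = 0 \<longleftrightarrow> x = 0"
  by (metis ip_definite ip_self ip_zero_right of_real_eq_0_iff zero_eq_power2)

lemma hnorm_zero [simp]: "hnorm H 0 = 0"
  by (simp add: hnorm_eq_0_iff)

lemma Re_ip_commute: "\<lbrakk>x \<in> carr H; y \<in> carr H\<rbrakk> \<Longrightarrow> Re (ip H y x) = Re (ip H x y)"
  by (simp add: ip_commute[of x y])

lemma hnorm_add_sq:
  "\<lbrakk>x \<in> carr H; y \<in> carr H\<rbrakk> \<Longrightarrow>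
    (hnorm H (x + y))\<^sup>2 = (hnorm H x)\<^sup>2 + 2 * Re (ip H x y) + (hnorm H y)\<^sup>2"
  using Re_ip_commute[of x y] by (simp add: hnorm_sq ip_add_left ip_add_right)

lemma hnorm_diff_sq:
  "\<lbrakk>x \<in> carr H; y \<in> carr H\<rbrakk> \<Longrightarrow>
    (hnorm H (x - y))\<^sup>2 = (hnorm H x)\<^sup>2 - 2 * Re (ip H x y) + (hnorm H y)\<^sup>2"
  using Re_ip_commute[of x y] by (simp add: hnorm_sq ip_diff_left ip_diff_right)

lemma hnorm_scale: "x \<in> carr H \<Longrightarrow> hnorm H (c *\<^sub>C x) = cmod c * hnorm H x"
proof -
  assume x: "x \<in> carr H"
  have "ip H (c *\<^sub>C x) (c *\<^sub>C x) = (c * cnj c) * ip H x x"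
    using x by (simp add: ip_scale_left ip_scale_right)
  also have "\<dots> = complex_of_real ((cmod c * hnorm H x)\<^sup>2)"
    using x by (simp add: ip_self complex_norm_square[symmetric] power_mult_distrib)
  finally have "(hnorm H (c *\<^sub>C x))\<^sup>2 = (cmod c * hnorm H x)\<^sup>2"
    using x hnorm_sq[of "c *\<^sub>C x"] by simp
  then show ?thesis using x by (subst (asm) power2_eq_iff_nonneg) auto
qed

lemma hnorm_diff_commute: "\<lbrakk>x \<in> carr H; y \<in> carr H\<rbrakk> \<Longrightarrow> hnorm H (x - y) = hnorm H (y - x)"
  using hnorm_scale[of "y - x" "-1"] by (simp add: scaleC_one)

text \<open>\<open>c\<close> makes \<open>z - c y\<close> orthogonal to \<open>y\<close>, so this is
  Pythagoras. It serves both the Cauchy-Schwarz inequality and the optimality argument for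
  projections.\<close>

lemma hnorm_sq_residual:
  assumes y: "y \<in> carr H" "y \<noteq> 0" and z: "z \<in> carr H"
  defines "c \<equiv> ip H y z / complex_of_real ((hnorm H y)\<^sup>2)"
  shows "(hnorm H (z - c *\<^sub>C y))\<^sup>2 = (hnorm H z)\<^sup>2 - (cmod (ip H y z) / hnorm H y)\<^sup>2"
proof -
  have n: "hnorm H y \<noteq> 0" using y hnorm_eq_0_iff by simp
  have "ip H z (c *\<^sub>C y) = (ip H y z * cnj (ip H y z)) / complex_of_real ((hnorm H y)\<^sup>2)"
    using y z ip_commute[of y z] by (simp add: ip_scale_right c_def)
  also have "\<dots> = complex_of_real ((cmod (ip H y z) / hnorm H y)\<^sup>2)"
    by (simp add: complex_norm_square[symmetric] power_divide)
  finally have "Re (ip H z (c *\<^sub>C y)) = (cmod (ip H y z) / hnorm H y)\<^sup>2" by simp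
  moreover have "hnorm H (c *\<^sub>C y) = cmod (ip H y z) / hnorm H y"
    using y n by (simp add: hnorm_scale c_def norm_divide norm_power)
      (simp add: power2_eq_square)
  ultimately show ?thesis using hnorm_diff_sq[of z "c *\<^sub>C y"] y z by simp
qed

lemma cauchy_schwarz:
  assumes x: "x \<in> carr H" and y: "y \<in> carr H"
  shows "cmod (ip H x y) \<le> hnorm H x * hnorm H y"
proof (cases "x = 0")
  case False
  have n: "hnorm H x > 0" using False x hnorm_eq_0_iff[OF x] hnorm_nonneg[OF x] by linarith
  have "(cmod (ip H x y) / hnorm H x)\<^sup>2 \<le> (hnorm H y)\<^sup>2"
    using hnorm_sq_residual[OF x False y] 
      zero_le_power2[of "hnorm H (y - (ip H x y / complex_of_real ((hnorm H x)\<^sup>2)) *\<^sub>C x)"] by linarith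
  then have "cmod (ip H x y) / hnorm H x \<le> hnorm H y"
    using y by (auto dest: power2_le_imp_le)
  then show ?thesis using n by (simp add: divide_le_eq mult.commute)
qed (use y in simp)

lemma hnorm_triangle:
  assumes x: "x \<in> carr H" and y: "y \<in> carr H"
  shows "hnorm H (x + y) \<le> hnorm H x + hnorm H y"
proof (rule power2_le_imp_le)
  show "(hnorm H (x + y))\<^sup>2 \<le> (hnorm H x + hnorm H y)\<^sup>2"
    using hnorm_add_sq[OF x y] cauchy_schwarz[OF x y] complex_Re_le_cmod[of "ip H x y"]
    by (simp add: power2_sum)
qed (use x y in simp)

lemma hnorm_triangle_diff:
  "\<lbrakk>x \<in> carr H; y \<in> carr H; z \<in> carr H\<rbrakk> \<Longrightarrow> hnorm H (x - z) \<le> hnorm H (x - y) + hnorm H (y - z)"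
  using hnorm_triangle[of "x - y" "y - z"] by simp

lemma parallelogram:
  "\<lbrakk>x \<in> carr H; y \<in> carr H\<rbrakk> \<Longrightarrow>
    (hnorm H (x + y))\<^sup>2 + (hnorm H (x - y))\<^sup>2 = 2 * (hnorm H x)\<^sup>2 + 2 * (hnorm H y)\<^sup>2"
  by (simp add: hnorm_add_sq hnorm_diff_sq)

lemma eq_if_ip_eq:
  assumes "x \<in> carr H" "y \<in> carr H" "\<And>z. z \<in> carr H \<Longrightarrow> ip H x z = ip H y z"
  shows "x = y"
  using assms ip_definite[of "x - y"] by (simp add: ip_diff_left)

lemma ip_ortho_commute: "\<lbrakk>x \<in> carr H; y \<in> carr H\<rbrakk> \<Longrightarrow> ip H x y = 0 \<longleftrightarrow> ip H y x = 0"
  using ip_commute[of x y] by simp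

section \<open>Orthogonal complements, closest points and bounded functionals\<close>

lemma subspace_ortho: "S \<subseteq> carr H \<Longrightarrow> cvec.subspace (ortho H S)"
  by (rule cvec.subspaceI) (auto simp: ortho_def ip_add_right ip_scale_right subset_iff)

text \<open>Stated through sequences and \<open>hnorm\<close>, since the norm of \<open>H\<close>
  lives on a carrier and induces no topology on the type.\<close>

definition seq_closed :: "'a set \<Rightarrow> bool" where
  "seq_closed S \<longleftrightarrow>
    (\<forall>s l. (\<forall>n. s n \<in> S) \<longrightarrow> l \<in> carr H \<longrightarrow> (\<lambda>n. hnorm H (s n - l)) \<longlonglongrightarrow> 0 \<longrightarrow> l \<in> S)"

text \<open>A sequence in \<open>S\<close> minimizing the distance to \<open>x\<close> is Cauchy by
  the parallelogram law. Its limit \<open>p\<close> is a closest point, and if \<open>x - p\<close>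
  were not orthogonal to some \<open>y\<close> in \<open>S\<close>, moving along \<open>y\<close>
  would come closer.\<close>

theorem projection_theorem:
  assumes S: "cvec.subspace S" "S \<subseteq> carr H" "seq_closed S" and x: "x \<in> carr H"
  obtains p where "p \<in> S" "x - p \<in> ortho H S"
proof -
  define d where "d = (INF s\<in>S. (hnorm H (x - s))\<^sup>2)"
  have S0: "0 \<in> S" using S(1) by (rule cvec.subspace_0)
  have bdd: "bdd_below ((\<lambda>s. (hnorm H (x - s))\<^sup>2) ` S)" by (auto intro!: bdd_belowI[of _ 0])
  have d_le: "d \<le> (hnorm H (x - s))\<^sup>2" if "s \<in> S" for s
    unfolding d_def using bdd that by (rule cINF_lower)
  have "\<exists>s\<in>S. (hnorm H (x - s))\<^sup>2 < d + 1 / real (Suc n)" for n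
    using S0 bdd cINF_less_iff[of S "\<lambda>s. (hnorm H (x - s))\<^sup>2" "d + 1 / real (Suc n)"]
    by (auto simp: d_def)
  then obtain s where s: "\<And>n. s n \<in> S" "\<And>n. (hnorm H (x - s n))\<^sup>2 < d + 1 / real (Suc n)"
    unfolding Bex_def by metis
  have sH: "s n \<in> carr H" for n using s S by auto
  have close: "(hnorm H (s m - s n))\<^sup>2 \<le> 2 / real (Suc m) + 2 / real (Suc n)" for m n
  proof -
    \<comment> \<open>The midpoint of \<open>s m\<close> and \<open>s n\<close> lies in
      \<open>S\<close>, so its squared distance to \<open>x\<close> is at least \<open>d\<close>;
      this controls \<open>s m - s n\<close>.\<close>
    define a where "a = (1/2) *\<^sub>C (s m + s n)"
    have a: "a \<in> S" unfolding a_def using S(1) s by (intro cvec.subspace_scale cvec.subspace_add)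
    have "2 *\<^sub>C a = s m + s n" by (simp add: a_def scaleC_scaleC scaleC_one)
    moreover have "2 *\<^sub>C x = x + x" using scaleC_add_left[of 1 1 x] by (simp add: scaleC_one)
    ultimately have "(x - s m) + (x - s n) = 2 *\<^sub>C (x - a)"
      by (simp add: cvec.scale_right_diff_distrib)
    then have "(hnorm H ((x - s m) + (x - s n)))\<^sup>2 = 4 * (hnorm H (x - a))\<^sup>2"
      using x a S by (subst \<open>_ = 2 *\<^sub>C (x - a)\<close>, subst hnorm_scale) (auto simp: power_mult_distrib)
    moreover have "hnorm H ((x - s m) - (x - s n)) = hnorm H (s m - s n)"
      using hnorm_diff_commute[of "s m" "s n"] sH by simp
    ultimately have "(hnorm H (s m - s n))\<^sup>2 =
        2 * (hnorm H (x - s m))\<^sup>2 + 2 * (hnorm H (x - s n))\<^sup>2 - 4 * (hnorm H (x - a))\<^sup>2"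
      using parallelogram[of "x - s m" "x - s n"] x sH by simp
    then show ?thesis using d_le[OF a] s(2)[of m] s(2)[of n] by simp
  qed
  have "\<exists>N. \<forall>m\<ge>N. \<forall>n\<ge>N. hnorm H (s m - s n) < e" if e: "e > 0" for e
  proof -
    obtain N where "4 / e\<^sup>2 < real N" using reals_Archimedean2 by blast
    then have N: "4 / e\<^sup>2 < real (Suc N)" by simp
    show ?thesis
    proof (intro exI[of _ N] allI impI)
      fix m n assume "N \<le> m" "N \<le> n"
      then have "2 / real (Suc m) \<le> 2 / real (Suc N)" "2 / real (Suc n) \<le> 2 / real (Suc N)"
        by (simp_all add: frac_le)
      with close[of m n] have "(hnorm H (s m - s n))\<^sup>2 \<le> 4 / real (Suc N)" by simp
      also have "\<dots> < e\<^sup>2" using N e by (simp add: field_simps)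
      finally show "hnorm H (s m - s n) < e" using e by (simp add: power_less_imp_less_base)
    qed
  qed
  then obtain p where p: "p \<in> carr H" "(\<lambda>n. hnorm H (s n - p)) \<longlonglongrightarrow> 0"
    using complete[of s] sH by blast
  then have pS: "p \<in> S" using S(3) s(1) unfolding seq_closed_def by blast
  have "hnorm H (x - p) \<le> sqrt (d + 1 / real (Suc n)) + hnorm H (s n - p)" for n
  proof -
    have "hnorm H (x - s n) \<le> sqrt (d + 1 / real (Suc n))"
      using s(2)[of n] by (intro real_le_rsqrt) simp
    then show ?thesis using hnorm_triangle_diff[OF x sH p(1), of n] by linarith
  qed
  moreover have "(\<lambda>n. sqrt (d + 1 / real (Suc n)) + hnorm H (s n - p)) \<longlonglongrightarrow> sqrt (d + 0) + 0"
    by (intro tendsto_intros p LIMSEQ_Suc[OF lim_1_over_n])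
  ultimately have "hnorm H (x - p) \<le> sqrt d"
    by (intro LIMSEQ_le_const) auto
  then have min: "(hnorm H (x - p))\<^sup>2 \<le> d"
    using x p real_sqrt_le_iff[of "(hnorm H (x - p))\<^sup>2" d] by simp
  have "ip H y (x - p) = 0" if y: "y \<in> S" for y
  proof (cases "y = 0")
    case False
    define z where "z = x - p"
    \<comment> \<open>The coefficient of the component of \<open>z\<close> along \<open>y\<close>;
      replacing \<open>p\<close> by \<open>p + c y\<close> cannot decrease the distance to
      \<open>x\<close>.\<close>
    define c where "c = ip H y z / complex_of_real ((hnorm H y)\<^sup>2)"
    have yz: "y \<in> carr H" "z \<in> carr H" using y S x p by (auto simp: z_def)
    have "p + c *\<^sub>C y \<in> S" using S(1) pS y by (intro cvec.subspace_add cvec.subspace_scale)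
    then have "(hnorm H z)\<^sup>2 \<le> (hnorm H (z - c *\<^sub>C y))\<^sup>2"
      using d_le[of "p + c *\<^sub>C y"] min by (simp add: z_def diff_diff_eq)
    then have "(cmod (ip H y z) / hnorm H y)\<^sup>2 \<le> 0"
      using hnorm_sq_residual[of y z, folded c_def] yz False by linarith
    then show ?thesis using yz False by (simp add: z_def hnorm_eq_0_iff)
  qed (use x p in simp)
  then have "x - p \<in> ortho H S" using x p by (simp add: ortho_def)
  with pS that show ?thesis by blast
qed

text \<open>As \<open>proj\<close> is a definite description, uniqueness has to be shown: for a
  second candidate \<open>p\<close>, the vector \<open>q - p\<close> is orthogonal to
  \<open>k\<close> and to \<open>k + q - p\<close>, hence to itself.\<close>

lemma proj_ortho_eq:
  assumes "N \<subseteq> carr H" "k \<in> N" "q \<in> ortho H N"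
  shows "proj H (ortho H N) (k + q) = q"
  unfolding proj_def
proof (rule the_equality)
  show "q \<in> ortho H N \<and> k + q - q \<in> ortho H (ortho H N)"
    using assms ip_ortho_commute[of k] by (auto simp: ortho_def)
next
  fix p assume p: "p \<in> ortho H N \<and> k + q - p \<in> ortho H (ortho H N)"
  have H: "k \<in> carr H" "q \<in> carr H" "p \<in> carr H" using assms p by (auto simp: ortho_def)
  have "q - p \<in> ortho H N"
    using assms p by (intro cvec.subspace_diff subspace_ortho) auto
  then have "ip H (q - p) (k + q - p) = 0" "ip H k (q - p) = 0"
    using p assms by (auto simp: ortho_def)
  then have "ip H (q - p) (q - p) = 0"
    using ip_add_right[of "q - p" k "q - p"] ip_ortho_commute[of "q - p" k] H
    by (simp add: add_diff_eq)
  then show "p = q" using ip_definite[of "q - p"] H by simp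
qed

text \<open>The bound makes the kernel of \<phi> closed, so unless \<phi> vanishes there is a
  \<open>w\<close> orthogonal to the kernel with \<open>\<phi> w\<close> nonzero; a multiple of
  \<open>w\<close> represents \<phi>.\<close>

theorem riesz_representation:
  assumes add: "\<And>x y. \<lbrakk>x \<in> carr H; y \<in> carr H\<rbrakk> \<Longrightarrow> \<phi> (x + y) = \<phi> x + \<phi> y"
    and scale: "\<And>c x. x \<in> carr H \<Longrightarrow> \<phi> (c *\<^sub>C x) = c * \<phi> x"
    and bound: "\<And>x. x \<in> carr H \<Longrightarrow> cmod (\<phi> x) \<le> C * hnorm H x"
  obtains z where "z \<in> carr H" "\<And>x. x \<in> carr H \<Longrightarrow> ip H z x = \<phi> x"
proof (cases "\<forall>x\<in>carr H. \<phi> x = 0")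
  case True
  then show ?thesis using that[of 0] by simp
next
  case False
  then obtain x0 where x0: "x0 \<in> carr H" "\<phi> x0 \<noteq> 0" by blast
  define N where "N = {x \<in> carr H. \<phi> x = 0}"
  have diff: "\<phi> (x - y) = \<phi> x - \<phi> y" if "x \<in> carr H" "y \<in> carr H" for x y
    using add[of "x - y" y] that by simp
  have N: "cvec.subspace N" "N \<subseteq> carr H"
    using scale[of 0 0] by (auto simp: N_def add scale intro!: cvec.subspaceI)
  have "seq_closed N"
    unfolding seq_closed_def
  proof (intro allI impI)
    fix s l assume s: "\<forall>n. s n \<in> N" and l: "l \<in> carr H" and lim: "(\<lambda>n. hnorm H (s n - l)) \<longlonglongrightarrow> 0"
    have "cmod (\<phi> l) \<le> C * hnorm H (s n - l)" for n
      using bound[of "s n - l"] s l diff[of "s n" l] by (simp add: N_def)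
    moreover have "(\<lambda>n. C * hnorm H (s n - l)) \<longlonglongrightarrow> C * 0" by (intro tendsto_intros lim)
    ultimately have "cmod (\<phi> l) \<le> 0" by (intro LIMSEQ_le_const) auto
    then show "l \<in> N" using l by (simp add: N_def)
  qed
  then obtain p where p: "p \<in> N" "x0 - p \<in> ortho H N"
    using projection_theorem N x0 by blast
  define w where "w = x0 - p"
  have w: "w \<in> carr H" "\<phi> w = \<phi> x0" using p x0 diff by (auto simp: w_def N_def)
  then have w0: "ip H w w \<noteq> 0" using x0 ip_definite scale[of 0 0] by fastforce
  \<comment> \<open>The conjugate compensates the conjugate linearity of \<open>ip\<close> in its
    first argument.\<close>
  define z where "z = cnj (\<phi> w / ip H w w) *\<^sub>C w"
  show ?thesis
  proof (rule that[of z])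
    show "z \<in> carr H" using w by (simp add: z_def)
    fix x assume x: "x \<in> carr H"
    have "\<phi> w *\<^sub>C x - \<phi> x *\<^sub>C w \<in> N" using x w by (simp add: N_def diff scale)
    then have "ip H (\<phi> w *\<^sub>C x - \<phi> x *\<^sub>C w) w = 0" using p by (simp add: ortho_def w_def)
    then have "ip H w (\<phi> w *\<^sub>C x - \<phi> x *\<^sub>C w) = 0"
      using ip_ortho_commute x w by blast
    then show "ip H z x = \<phi> x"
      using x w w0 by (simp add: ip_diff_right ip_scale_right ip_scale_left z_def field_simps)
  qed
qed

end

section \<open>Adjoints\<close>

text \<open>The Riesz representative of the functional \<open>ip K y (T x)\<close> in
  \<open>x\<close>. Both spaces are arguments because the adjoint depends on both inner
  products.\<close>

definition adj ::
    "'a :: complex_vector hilb \<Rightarrow> 'b :: complex_vector hilb \<Rightarrow> ('a \<Rightarrow> 'b) \<Rightarrow> 'b \<Rightarrow> 'a" where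
  "adj H K T y = (SOME z. z \<in> carr H \<and> (\<forall>x\<in>carr H. ip H z x = ip K y (T x)))"

locale bounded_operator =
  dom: hilbert_space H + cod: hilbert_space K
  for H :: "'a :: complex_vector hilb" and K :: "'b :: complex_vector hilb" and T :: "'a \<Rightarrow> 'b" +
  assumes bounded: "bounded_op H K T"
begin

lemma mem [simp]: "x \<in> carr H \<Longrightarrow> T x \<in> carr K"
  and add: "\<lbrakk>x \<in> carr H; y \<in> carr H\<rbrakk> \<Longrightarrow> T (x + y) = T x + T y"
  and scale: "x \<in> carr H \<Longrightarrow> T (c *\<^sub>C x) = c *\<^sub>C T x"
  using bounded by (auto simp: bounded_op_def)

lemma zero: "T 0 = 0"
  using scale[of 0 0] by simp

lemma diff: "\<lbrakk>x \<in> carr H; y \<in> carr H\<rbrakk> \<Longrightarrow> T (x - y) = T x - T y"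
  using add[of "x - y" y] by simp

lemma bound: obtains C where "C > 0" "\<And>x. x \<in> carr H \<Longrightarrow> hnorm K (T x) \<le> C * hnorm H x"
proof -
  have "\<exists>C. \<forall>x\<in>carr H. hnorm K (T x) \<le> C * hnorm H x" using bounded by (simp add: bounded_op_def)
  then obtain C where C: "\<And>x. x \<in> carr H \<Longrightarrow> hnorm K (T x) \<le> C * hnorm H x" by blast
  \<comment> \<open>A bound \<open>C\<close> can be negative when \<open>H\<close> is trivial;
    \<open>\<bar>C\<bar> + 1\<close> is positive.\<close>
  have "hnorm K (T x) \<le> (\<bar>C\<bar> + 1) * hnorm H x" if "x \<in> carr H" for x
  proof -
    have "C * hnorm H x \<le> (\<bar>C\<bar> + 1) * hnorm H x" using that by (intro mult_right_mono) auto
    then show ?thesis using C[OF that] by linarith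
  qed
  then show ?thesis using that[of "\<bar>C\<bar> + 1"] by simp
qed

lemma sum: "(\<And>i. i \<in> I \<Longrightarrow> f i \<in> carr H) \<Longrightarrow> T (sum f I) = (\<Sum>i\<in>I. T (f i))"
  by (induction I rule: infinite_finite_induct) (auto simp: zero add)

lemma adj_spec:
  assumes y: "y \<in> carr K"
  shows "adj H K T y \<in> carr H \<and> (\<forall>x\<in>carr H. ip H (adj H K T y) x = ip K y (T x))"
proof -
  obtain C where C: "C > 0" "\<And>x. x \<in> carr H \<Longrightarrow> hnorm K (T x) \<le> C * hnorm H x"
    using bound by blast
  have "cmod (ip K y (T x)) \<le> (hnorm K y * C) * hnorm H x" if "x \<in> carr H" for x
    using cod.cauchy_schwarz[of y "T x"] y that mult_left_mono[OF C(2)[OF that], of "hnorm K y"]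
    by simp
  then obtain z where "z \<in> carr H" "\<And>x. x \<in> carr H \<Longrightarrow> ip H z x = ip K y (T x)"
    using dom.riesz_representation[of "\<lambda>x. ip K y (T x)" "hnorm K y * C"] y
    by (auto simp: add scale cod.ip_add_right cod.ip_scale_right)
  then have "\<exists>z. z \<in> carr H \<and> (\<forall>x\<in>carr H. ip H z x = ip K y (T x))" by blast
  then show ?thesis unfolding adj_def by (rule someI_ex)
qed

lemma adj_carr [simp]: "y \<in> carr K \<Longrightarrow> adj H K T y \<in> carr H"
  using adj_spec by blast

lemma adj_ip: "\<lbrakk>x \<in> carr H; y \<in> carr K\<rbrakk> \<Longrightarrow> ip H (adj H K T y) x = ip K y (T x)"
  using adj_spec by blast

lemma adj_ip_right: "\<lbrakk>x \<in> carr H; y \<in> carr K\<rbrakk> \<Longrightarrow> ip H x (adj H K T y) = ip K (T x) y"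
  using adj_ip[of x y] dom.ip_commute[of x "adj H K T y"] cod.ip_commute[of "T x" y]
  by (metis adj_carr mem complex_cnj_cnj)

lemma adj_add: "\<lbrakk>x \<in> carr K; y \<in> carr K\<rbrakk> \<Longrightarrow> adj H K T (x + y) = adj H K T x + adj H K T y"
  by (rule dom.eq_if_ip_eq) (auto simp: dom.ip_add_left adj_ip cod.ip_add_left)

lemma adj_scale: "x \<in> carr K \<Longrightarrow> adj H K T (c *\<^sub>C x) = c *\<^sub>C adj H K T x"
  by (rule dom.eq_if_ip_eq) (auto simp: dom.ip_scale_left adj_ip cod.ip_scale_left)

lemma adj_diff: "\<lbrakk>x \<in> carr K; y \<in> carr K\<rbrakk> \<Longrightarrow> adj H K T (x - y) = adj H K T x - adj H K T y"
  using adj_add[of "x - y" y] by simp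

lemma adj_zero [simp]: "adj H K T 0 = 0"
  using adj_scale[of 0 0] by simp

text \<open>Inserting \<open>x = adj H K T y\<close> in the defining identity bounds its squared
  norm by \<open>C\<close> times its norm times the norm of \<open>y\<close>; one factor
  cancels.\<close>

lemma adj_bound:
  assumes C: "0 \<le> C" "\<And>x. x \<in> carr H \<Longrightarrow> hnorm K (T x) \<le> C * hnorm H x" and y: "y \<in> carr K"
  shows "hnorm H (adj H K T y) \<le> C * hnorm K y"
proof -
  define z where "z = adj H K T y"
  have z: "z \<in> carr H" using y by (simp add: z_def)
  have "(hnorm H z)\<^sup>2 = cmod (ip H z z)" using z by (simp add: dom.ip_self norm_power)
  also have "\<dots> = cmod (ip K y (T z))" using z y by (simp add: z_def adj_ip)
  also have "\<dots> \<le> hnorm K y * hnorm K (T z)" using z y by (simp add: cod.cauchy_schwarz)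
  also have "\<dots> \<le> hnorm K y * (C * hnorm H z)" using z y by (intro mult_left_mono C(2)) auto
  finally have le: "hnorm H z * hnorm H z \<le> (C * hnorm K y) * hnorm H z"
    by (simp add: power2_eq_square mult_ac)
  show ?thesis
  proof (cases "hnorm H z = 0")
    case True
    then show ?thesis using C(1) y by (simp add: z_def)
  next
    case False
    then have "hnorm H z > 0" using dom.hnorm_nonneg[OF z] by simp
    then show ?thesis using le by (simp add: z_def)
  qed
qed

lemma subspace_ker: "cvec.subspace (ker_op H T)"
  by (rule cvec.subspaceI) (auto simp: ker_op_def zero add scale)

lemma seq_closed_ker: "dom.seq_closed (ker_op H T)"
  unfolding dom.seq_closed_def
proof (intro allI impI)
  fix s l assume s: "\<forall>n. s n \<in> ker_op H T" and l: "l \<in> carr H"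
    and lim: "(\<lambda>n. hnorm H (s n - l)) \<longlonglongrightarrow> 0"
  obtain C where C: "C > 0" "\<And>x. x \<in> carr H \<Longrightarrow> hnorm K (T x) \<le> C * hnorm H x"
    using bound by blast
  have "hnorm K (T l) \<le> C * hnorm H (s n - l)" for n
    using C(2)[of "l - s n"] s l diff[of l "s n"] dom.hnorm_diff_commute[of l "s n"]
    by (simp add: ker_op_def)
  moreover have "(\<lambda>n. C * hnorm H (s n - l)) \<longlonglongrightarrow> C * 0" by (intro tendsto_intros lim)
  ultimately have "hnorm K (T l) \<le> 0" by (intro LIMSEQ_le_const) auto
  then have "hnorm K (T l) = 0" using l by (intro antisym) auto
  then show "l \<in> ker_op H T" using l by (simp add: ker_op_def cod.hnorm_eq_0_iff)
qed

text \<open>The projection removes the component of \<open>x\<close> in the kernel, which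
  \<open>T\<close> does not see; the norm bound is Pythagoras.\<close>

lemma proj_ker_ortho:
  assumes x: "x \<in> carr H"
  defines "q \<equiv> proj H (ortho H (ker_op H T)) x"
  shows "q \<in> carr H" "T q = T x" "hnorm H q \<le> hnorm H x"
proof -
  have sub: "ker_op H T \<subseteq> carr H" by (auto simp: ker_op_def)
  obtain k where k: "k \<in> ker_op H T" "x - k \<in> ortho H (ker_op H T)"
    using dom.projection_theorem[OF subspace_ker sub seq_closed_ker x] .
  then have q: "q = x - k" unfolding q_def using dom.proj_ortho_eq[OF sub k] by simp
  have kH: "k \<in> carr H" "T k = 0" using k by (auto simp: ker_op_def)
  show qH: "q \<in> carr H" and "T q = T x" using q kH x by (simp_all add: diff)
  have "ip H k q = 0" "k + q = x" using k by (simp_all add: ortho_def q)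
  then have "(hnorm H x)\<^sup>2 = (hnorm H k)\<^sup>2 + (hnorm H q)\<^sup>2"
    using dom.hnorm_add_sq[OF kH(1) qH] by simp
  then show "hnorm H q \<le> hnorm H x" using x by (auto intro: power2_le_imp_le[of _ "hnorm H x"])
qed

end

section \<open>Completeness of the Fock space\<close>

context hilbert_space
begin

lemma fock_carr_iff:
  "f \<in> carr (fock H) \<longleftrightarrow>
    (\<forall>\<alpha>. f \<alpha> \<in> carr H) \<and> (\<lambda>\<alpha>. (hnorm H (f \<alpha>))\<^sup>2) summable_on UNIV"
  by (simp add: fock_def)

lemma fock_carr_nth [simp]: "f \<in> carr (fock H) \<Longrightarrow> f \<alpha> \<in> carr H"
  by (simp add: fock_def)

lemma fock_carr_bounded_partial_sums:
  assumes "\<And>\<alpha>. f \<alpha> \<in> carr H" "\<And>A. finite A \<Longrightarrow> (\<Sum>\<alpha>\<in>A. (hnorm H (f \<alpha>))\<^sup>2) \<le> c"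
  shows "f \<in> carr (fock H)"
  unfolding fock_carr_iff using assms
  by (auto intro!: nonneg_bdd_above_summable_on bdd_aboveI[of _ c])

text \<open>Termwise domination by Cauchy-Schwarz and
  \<open>a b \<le> a\<^sup>2 + b\<^sup>2\<close>.\<close>

lemma fock_ip_summable:
  assumes "f \<in> carr (fock H)" "g \<in> carr (fock H)"
  shows "(\<lambda>\<alpha>. ip H (f \<alpha>) (g \<alpha>)) summable_on UNIV"
proof (rule abs_summable_summable, rule Infinite_Sum.abs_summable_on_comparison_test')
  show "(\<lambda>\<alpha>. (hnorm H (f \<alpha>))\<^sup>2 + (hnorm H (g \<alpha>))\<^sup>2) summable_on UNIV"
    using assms by (intro summable_on_add) (simp_all add: fock_carr_iff)
  fix \<alpha>
  have *: "0 \<le> hnorm H (f \<alpha>) * hnorm H (g \<alpha>)" using assms by simp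
  show "cmod (ip H (f \<alpha>) (g \<alpha>)) \<le> (hnorm H (f \<alpha>))\<^sup>2 + (hnorm H (g \<alpha>))\<^sup>2"
    using cauchy_schwarz[OF fock_carr_nth fock_carr_nth, OF assms, of \<alpha> \<alpha>] *
      sum_squares_bound[of "hnorm H (f \<alpha>)" "hnorm H (g \<alpha>)"]
    by linarith
qed

lemma fock_ip: "ip (fock H) f g = (\<Sum>\<^sub>\<infinity>\<alpha>. ip H (f \<alpha>) (g \<alpha>))"
  unfolding fock_def by simp

lemma fock_ip_self:
  "f \<in> carr (fock H) \<Longrightarrow> ip (fock H) f f = complex_of_real (\<Sum>\<^sub>\<infinity>\<alpha>. (hnorm H (f \<alpha>))\<^sup>2)"
  unfolding fock_ip
  by (rule infsumI) (simp add: ip_self fock_carr_iff has_sum_of_real_iff del: of_real_power)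

lemma fock_hnorm_sq:
  "f \<in> carr (fock H) \<Longrightarrow> (hnorm (fock H) f)\<^sup>2 = (\<Sum>\<^sub>\<infinity>\<alpha>. (hnorm H (f \<alpha>))\<^sup>2)"
  by (simp add: hnorm_def[of "fock H"] fock_ip_self infsum_nonneg)

lemma fock_hnorm_nonneg: "f \<in> carr (fock H) \<Longrightarrow> 0 \<le> hnorm (fock H) f"
  by (simp add: hnorm_def[of "fock H"] fock_ip_self infsum_nonneg)

lemma fock_partial_sum_le:
  assumes "f \<in> carr (fock H)" "finite A"
  shows "(\<Sum>\<alpha>\<in>A. (hnorm H (f \<alpha>))\<^sup>2) \<le> (hnorm (fock H) f)\<^sup>2"
  unfolding fock_hnorm_sq[OF assms(1)]
  using assms by (intro finite_sum_le_infsum) (simp_all add: fock_carr_iff)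

lemma fock_hnorm_nth_le:
  assumes "f \<in> carr (fock H)"
  shows "hnorm H (f \<alpha>) \<le> hnorm (fock H) f"
  using fock_partial_sum_le[OF assms, of "{\<alpha>}"] fock_hnorm_nonneg[OF assms]
  by (auto dest: power2_le_imp_le)

lemma hnorm_le_if_partial_sums_le:
  assumes "f \<in> carr (fock H)" "\<And>A. finite A \<Longrightarrow> (\<Sum>\<alpha>\<in>A. (hnorm H (f \<alpha>))\<^sup>2) \<le> c\<^sup>2" "0 \<le> c"
  shows "hnorm (fock H) f \<le> c"
proof (rule power2_le_imp_le)
  show "(hnorm (fock H) f)\<^sup>2 \<le> c\<^sup>2"
    unfolding fock_hnorm_sq[OF assms(1)]
    using assms by (intro infsum_le_finite_sums) (simp_all add: fock_carr_iff)
qed (use assms in simp)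

lemma subspace_fock: "cvec.subspace (carr (fock H))"
proof (rule cvec.subspaceI)
  show "0 \<in> carr (fock H)" by (simp add: fock_carr_iff)
next
  fix f g :: "'b list \<Rightarrow> 'a" assume f: "f \<in> carr (fock H)" and g: "g \<in> carr (fock H)"
  have "(\<lambda>\<alpha>. 2 * (hnorm H (f \<alpha>))\<^sup>2 + 2 * (hnorm H (g \<alpha>))\<^sup>2) summable_on UNIV"
    using f g by (intro summable_on_add summable_on_cmult_right) (simp_all add: fock_carr_iff)
  then have "(\<lambda>\<alpha>. (hnorm H (f \<alpha> + g \<alpha>))\<^sup>2) summable_on UNIV"
  proof (rule summable_on_comparison_test)
    fix \<alpha>
    show "(hnorm H (f \<alpha> + g \<alpha>))\<^sup>2 \<le> 2 * (hnorm H (f \<alpha>))\<^sup>2 + 2 * (hnorm H (g \<alpha>))\<^sup>2"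
      using parallelogram[OF fock_carr_nth fock_carr_nth, OF f g, of \<alpha> \<alpha>]
        zero_le_power2[of "hnorm H (f \<alpha> - g \<alpha>)"] by linarith
  qed simp
  then show "f + g \<in> carr (fock H)"
    using f g by (simp add: fock_carr_iff)
next
  fix f :: "'b list \<Rightarrow> 'a" and c assume "f \<in> carr (fock H)"
  then show "c *\<^sub>C f \<in> carr (fock H)"
    by (simp add: fock_carr_iff scaleC_fun_def hnorm_scale power_mult_distrib
        summable_on_cmult_right)
qed

text \<open>For completeness, the coefficientwise limit \<open>l\<close> is the candidate. The
  Cauchy estimate on finite partial sums passes to the limit, uniformly in the finite set of words,
  which gives both membership and convergence.\<close>

theorem hilbert_space_fock: "hilbert_space (fock H :: ('d :: finite list \<Rightarrow> 'a) hilb)"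
proof
  show "cvec.subspace (carr (fock H))" by (rule subspace_fock)
next
  fix x y z :: "'d list \<Rightarrow> 'a"
  assume "x \<in> carr (fock H)" "y \<in> carr (fock H)" "z \<in> carr (fock H)"
  then show "ip (fock H) x (y + z) = ip (fock H) x y + ip (fock H) x z"
    by (simp add: fock_ip ip_add_right infsum_add fock_ip_summable)
next
  fix x y :: "'d list \<Rightarrow> 'a" and c
  assume "x \<in> carr (fock H)" "y \<in> carr (fock H)"
  then show "ip (fock H) x (c *\<^sub>C y) = c * ip (fock H) x y"
    by (simp add: fock_ip scaleC_fun_def ip_scale_right infsum_cmult_right')
next
  fix x y :: "'d list \<Rightarrow> 'a"
  assume "x \<in> carr (fock H)" "y \<in> carr (fock H)"
  then show "ip (fock H) y x = cnj (ip (fock H) x y)"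
    unfolding fock_ip infsum_cnj[symmetric] by (intro infsum_cong ip_commute) simp_all
next
  fix x :: "'d list \<Rightarrow> 'a"
  assume x: "x \<in> carr (fock H)"
  then show "0 \<le> Re (ip (fock H) x x)" by (simp add: fock_ip_self infsum_nonneg)
  assume "ip (fock H) x x = 0"
  then have "hnorm (fock H) x = 0" by (simp add: hnorm_def)
  then have "hnorm H (x \<alpha>) = 0" for \<alpha>
    using fock_hnorm_nth_le[OF x, of \<alpha>] x by (intro antisym) simp_all
  then show "x = 0" using x by (simp add: fun_eq_iff hnorm_eq_0_iff)
next
  fix s :: "nat \<Rightarrow> 'd list \<Rightarrow> 'a"
  assume s: "\<forall>n. s n \<in> carr (fock H)"
    and cauchy: "\<forall>e>0. \<exists>N. \<forall>m\<ge>N. \<forall>n\<ge>N. hnorm (fock H) (s m - s n) < e"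
  have diff: "s m - s n \<in> carr (fock H)" for m n
    using s subspace_fock by (auto intro: cvec.subspace_diff)
  have nth: "hnorm H (s m \<alpha> - s n \<alpha>) \<le> hnorm (fock H) (s m - s n)" for m n \<alpha>
    using fock_hnorm_nth_le[OF diff, of m n \<alpha>] by simp
  have "\<exists>l\<in>carr H. (\<lambda>n. hnorm H (s n \<alpha> - l)) \<longlonglongrightarrow> 0" for \<alpha>
  proof (rule complete)
    show "\<forall>e>0. \<exists>N. \<forall>m\<ge>N. \<forall>n\<ge>N. hnorm H (s m \<alpha> - s n \<alpha>) < e"
      using cauchy nth by (meson le_less_trans)
  qed (use s in simp)
  then obtain l where l: "\<And>\<alpha>. l \<alpha> \<in> carr H" "\<And>\<alpha>. (\<lambda>n. hnorm H (s n \<alpha> - l \<alpha>)) \<longlonglongrightarrow> 0"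
    by metis
  have tail: "(\<Sum>\<alpha>\<in>A. (hnorm H (s n \<alpha> - l \<alpha>))\<^sup>2) \<le> e\<^sup>2"
    if N: "\<forall>m\<ge>N. \<forall>n\<ge>N. hnorm (fock H) (s m - s n) < e" and n: "n \<ge> N" for N n e and A :: "'d list set"
  proof -
    have conv: "(\<lambda>m. hnorm H (s n \<alpha> - s m \<alpha>)) \<longlonglongrightarrow> hnorm H (s n \<alpha> - l \<alpha>)" for \<alpha>
    proof -
      have H: "s n \<alpha> \<in> carr H" "s m \<alpha> \<in> carr H" for m using s by simp_all
      have "\<bar>hnorm H (s n \<alpha> - s m \<alpha>) - hnorm H (s n \<alpha> - l \<alpha>)\<bar> \<le> hnorm H (s m \<alpha> - l \<alpha>)" for m
        using hnorm_triangle_diff[OF H(1) H(2)[of m] l(1)[of \<alpha>]]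
          hnorm_triangle_diff[OF H(1) l(1)[of \<alpha>] H(2)[of m]]
          hnorm_diff_commute[OF H(2)[of m] l(1)[of \<alpha>]] by linarith
      then have "(\<lambda>m. hnorm H (s n \<alpha> - s m \<alpha>) - hnorm H (s n \<alpha> - l \<alpha>)) \<longlonglongrightarrow> 0"
        by (intro Lim_null_comparison[OF always_eventually l(2)[of \<alpha>]]) simp
      then show ?thesis by (simp add: LIM_zero_iff)
    qed
    have "(\<Sum>\<alpha>\<in>A. (hnorm H (s n \<alpha> - s m \<alpha>))\<^sup>2) \<le> e\<^sup>2" if m: "m \<ge> N" and A: "finite A" for m
    proof -
      have "(\<Sum>\<alpha>\<in>A. (hnorm H (s n \<alpha> - s m \<alpha>))\<^sup>2) \<le> (hnorm (fock H) (s n - s m))\<^sup>2"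
        using fock_partial_sum_le[OF diff A, of n m] by simp
      also have "\<dots> \<le> e\<^sup>2"
        using N n m fock_hnorm_nonneg[OF diff, of n m] by (intro power_mono) (auto intro: less_imp_le)
      finally show ?thesis .
    qed
    moreover have "(\<lambda>m. \<Sum>\<alpha>\<in>A. (hnorm H (s n \<alpha> - s m \<alpha>))\<^sup>2) \<longlonglongrightarrow> (\<Sum>\<alpha>\<in>A. (hnorm H (s n \<alpha> - l \<alpha>))\<^sup>2)"
      by (intro tendsto_intros conv)
    \<comment> \<open>For infinite \<open>A\<close> the sum is 0 by convention.\<close>
    ultimately show ?thesis
      by (cases "finite A") (auto intro!: LIMSEQ_le_const2)
  qed
  have mem: "s n - l \<in> carr (fock H)"
    if "\<forall>m\<ge>N. \<forall>n\<ge>N. hnorm (fock H) (s m - s n) < e" "n \<ge> N" for N n e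
    using tail[OF that] s l by (intro fock_carr_bounded_partial_sums[of _ "e\<^sup>2"]) simp_all
  obtain N0 where N0: "\<forall>m\<ge>N0. \<forall>n\<ge>N0. hnorm (fock H) (s m - s n) < 1"
    using cauchy zero_less_one by blast
  \<comment> \<open>\<open>l\<close> is \<open>s N0\<close> minus the square-summable difference
    \<open>s N0 - l\<close>.\<close>
  have lmem: "l \<in> carr (fock H)"
    using mem[OF N0 order_refl] s cvec.subspace_diff[OF subspace_fock, of "s N0" "s N0 - l"] by simp
  have "(\<lambda>n. hnorm (fock H) (s n - l)) \<longlonglongrightarrow> 0"
  proof (rule LIMSEQ_I)
    fix r :: real assume "0 < r"
    then obtain N where N: "\<forall>m\<ge>N. \<forall>n\<ge>N. hnorm (fock H) (s m - s n) < r / 2"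
      using cauchy half_gt_zero by blast
    show "\<exists>N. \<forall>n\<ge>N. norm (hnorm (fock H) (s n - l) - 0) < r"
    proof (intro exI[of _ N] allI impI)
      fix n assume n: "n \<ge> N"
      have "hnorm (fock H) (s n - l) \<le> r / 2"
        using mem[OF N n] tail[OF N n] \<open>0 < r\<close> by (intro hnorm_le_if_partial_sums_le) simp_all
      then show "norm (hnorm (fock H) (s n - l) - 0) < r"
        using fock_hnorm_nonneg[OF mem[OF N n]] \<open>0 < r\<close> by simp
    qed
  qed
  with lmem show "\<exists>l\<in>carr (fock H). (\<lambda>n. hnorm (fock H) (s n - l)) \<longlonglongrightarrow> 0" by blast
qed

end

section \<open>Right shifts and multiplier ranges\<close>

lemma R_add: "R k (f + g) = R k f + R k g"
  and R_scale: "R k (c *\<^sub>C f) = c *\<^sub>C R k f"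
  and R_zero [simp]: "R k 0 = 0"
  by (auto simp: R_def fun_eq_iff scaleC_fun_def)

text \<open>Words ending in \<open>k\<close> are the injective image of all words under appending
  \<open>k\<close>, so families supported on them can be reindexed. This evaluates sums that involve
  \<open>R k\<close>.\<close>

lemma
  fixes g :: "'d list \<Rightarrow> 'b :: {comm_monoid_add, t2_space}"
  assumes "\<And>\<beta>. \<not> (\<beta> \<noteq> [] \<and> last \<beta> = k) \<Longrightarrow> g \<beta> = 0"
  shows infsum_snoc: "infsum g UNIV = (\<Sum>\<^sub>\<infinity>\<alpha>. g (\<alpha> @ [k]))"
    and summable_on_snoc_iff: "g summable_on UNIV \<longleftrightarrow> (\<lambda>\<alpha>. g (\<alpha> @ [k])) summable_on UNIV"
proof -
  have inj: "inj (\<lambda>\<alpha>. \<alpha> @ [k])" by (simp add: inj_def)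
  have 0: "g \<beta> = 0" if "\<beta> \<notin> range (\<lambda>\<alpha>. \<alpha> @ [k])" for \<beta>
    using that assms append_butlast_last_id by (metis rangeI)
  have "infsum g UNIV = infsum g (range (\<lambda>\<alpha>. \<alpha> @ [k]))"
    by (rule infsum_cong_neutral) (use 0 in auto)
  also have "\<dots> = (\<Sum>\<^sub>\<infinity>\<alpha>. g (\<alpha> @ [k]))"
    using infsum_reindex[OF inj, of g] by (simp add: o_def)
  finally show "infsum g UNIV = (\<Sum>\<^sub>\<infinity>\<alpha>. g (\<alpha> @ [k]))" .
  have "g summable_on UNIV \<longleftrightarrow> g summable_on (range (\<lambda>\<alpha>. \<alpha> @ [k]))"
    by (rule summable_on_cong_neutral) (use 0 in auto)
  also have "\<dots> \<longleftrightarrow> (\<lambda>\<alpha>. g (\<alpha> @ [k])) summable_on UNIV"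
    using summable_on_reindex[OF inj, of g] by (simp add: o_def)
  finally show "g summable_on UNIV \<longleftrightarrow> (\<lambda>\<alpha>. g (\<alpha> @ [k])) summable_on UNIV" .
qed

context hilbert_space
begin

lemma R_fock_carr [simp]:
  assumes "f \<in> carr (fock H)"
  shows "R k f \<in> carr (fock H)"
proof -
  have "(\<lambda>\<beta>. (hnorm H (R k f \<beta>))\<^sup>2) summable_on UNIV"
    using assms by (subst summable_on_snoc_iff[of k]) (auto simp: R_append fock_carr_iff R_def)
  then show ?thesis using assms by (simp add: fock_carr_iff R_def)
qed

text \<open>The adjoint of \<open>R k\<close> on the full Fock space is the backward shift, which
  reads coefficients at words with \<open>k\<close> appended.\<close>

lemma fock_ip_R_right:
  assumes "\<And>\<beta>. g \<beta> \<in> carr H"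
  shows "ip (fock H) g (R k f) = ip (fock H) (\<lambda>\<alpha>. g (\<alpha> @ [k])) f"
  unfolding fock_ip using assms by (subst infsum_snoc[of k]) (auto simp: R_append R_def)

lemma fock_ip_R_R:
  assumes "f \<in> carr (fock H)" "g \<in> carr (fock H)"
  shows "ip (fock H) (R j f) (R k g) = (if j = k then ip (fock H) f g else 0)"
proof -
  have "R j f \<beta> \<in> carr H" for \<beta> using R_fock_carr[OF assms(1)] by simp
  then have "ip (fock H) (R j f) (R k g) = ip (fock H) (\<lambda>\<alpha>. R j f (\<alpha> @ [k])) g"
    by (rule fock_ip_R_right)
  then show ?thesis using assms by (simp add: R_append fock_ip)
qed

lemma fock_hnorm_R: "f \<in> carr (fock H) \<Longrightarrow> hnorm (fock H) (R k f) = hnorm (fock H) f"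
  by (simp add: hnorm_def fock_ip_R_R)

text \<open>The \<open>R k\<close> are isometries with mutually orthogonal ranges, so the cross
  terms vanish.\<close>

lemma fock_hnorm_row_R:
  fixes y :: "'d :: finite \<Rightarrow> 'd list \<Rightarrow> 'a"
  assumes y: "\<And>k. y k \<in> carr (fock H)"
  shows "(hnorm (fock H) (\<Sum>k\<in>UNIV. R k (y k)))\<^sup>2 = (\<Sum>k\<in>UNIV. (hnorm (fock H) (y k))\<^sup>2)"
proof -
  interpret FH: hilbert_space "fock H :: ('d list \<Rightarrow> 'a) hilb" by (rule hilbert_space_fock)
  have "ip (fock H) (\<Sum>k\<in>UNIV. R k (y k)) (\<Sum>k\<in>UNIV. R k (y k))
      = (\<Sum>j\<in>UNIV. ip (fock H) (y j) (y j))"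
    using y by (simp add: FH.ip_sum_left FH.ip_sum_right fock_ip_R_R)
  then show ?thesis using y by (simp add: FH.hnorm_sq)
qed

lemma hnorm_direct_sum_sq:
  "x \<in> carr (direct_sum H) \<Longrightarrow> (hnorm (direct_sum H) x)\<^sup>2 = (\<Sum>k\<in>UNIV. (hnorm H (x k))\<^sup>2)"
  by (simp add: hnorm_def direct_sum_def ip_nonneg sum_nonneg)

lemma hnorm_direct_sum_nonneg: "x \<in> carr (direct_sum H) \<Longrightarrow> 0 \<le> hnorm (direct_sum H) x"
  by (simp add: hnorm_def direct_sum_def ip_nonneg sum_nonneg)

end

section \<open>Multiplier ranges carry a contractive row shift\<close>

theorem row_contraction_if_realizes:
  fixes J :: "'j :: complex_vector hilb" and M :: "('d :: finite list \<Rightarrow> 'j) hilb"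
    and F :: "'f :: complex_vector hilb"
  assumes "hilbert_space J" "hilbert_space M" "realizes J M F T"
  shows "bounded_op M (fock J) (\<lambda>x. x) \<and> (\<forall>k. R k ` carr M \<subseteq> carr M) \<and> row_contraction M R"
proof -
  interpret J: hilbert_space J by fact
  interpret M: hilbert_space M by fact
  interpret F: hilbert_space F using assms by (simp add: realizes_def)
  interpret T: bounded_operator "fock F" "fock J" T
    using assms J.hilbert_space_fock F.hilbert_space_fock
    by (simp add: bounded_operator_def bounded_operator_axioms_def realizes_def left_multiplier_def)
  have TR: "T (R k f) = R k (T f)" if "f \<in> carr (fock F)" for k f
    using assms that by (simp add: realizes_def left_multiplier_def)
  have carrM: "carr M = T ` carr (fock F)"
    and normM: "\<And>x. x \<in> carr (fock F) \<Longrightarrow>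
        hnorm M (T x) = hnorm (fock F) (proj (fock F) (ortho (fock F) (ker_op (fock F) T)) x)"
    using assms by (auto simp: realizes_def is_operator_range_def)
  have le: "hnorm M (T x) \<le> hnorm (fock F) x" if "x \<in> carr (fock F)" for x
    using T.proj_ker_ortho[OF that] normM[OF that] by simp
  \<comment> \<open>The lift is the projection of any preimage to the orthogonal complement of the
    kernel; its norm is the range norm by definition.\<close>
  have "\<exists>q. q \<in> carr (fock F) \<and> T q = m \<and> hnorm (fock F) q = hnorm M m" if "m \<in> carr M" for m
    using that T.proj_ker_ortho normM unfolding carrM by (metis imageE)
  then obtain q where q: "\<And>m. m \<in> carr M \<Longrightarrow> q m \<in> carr (fock F)"
      "\<And>m. m \<in> carr M \<Longrightarrow> T (q m) = m" "\<And>m. m \<in> carr M \<Longrightarrow> hnorm (fock F) (q m) = hnorm M m"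
    by metis
  obtain C where C: "\<And>x. x \<in> carr (fock F) \<Longrightarrow> hnorm (fock J) (T x) \<le> C * hnorm (fock F) x"
    using T.bound by blast
  have "hnorm (fock J) m \<le> C * hnorm M m" if "m \<in> carr M" for m
    using C[OF q(1)[OF that]] q(2,3)[OF that] by simp
  then have bounded: "bounded_op M (fock J) (\<lambda>x. x)"
    using carrM by (auto simp: bounded_op_def)
  have Rm: "R k m = T (R k (q m))" if "m \<in> carr M" for k m
    using q[OF that] TR by simp
  have R_mem: "R k m \<in> carr M" if "m \<in> carr M" for k m
    using Rm[OF that] q(1)[OF that] by (simp add: carrM)
  have "hnorm M (R k m) \<le> hnorm M m" if "m \<in> carr M" for k m
    using le[of "R k (q m)"] Rm[OF that] q(1,3)[OF that] F.fock_hnorm_R[of "q m" k] by simp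
  then have R_bounded: "bounded_op M M (R k)" for k
    unfolding bounded_op_def using R_mem by (auto simp: R_add R_scale intro: exI[of _ 1])
  have "hnorm M (row_op R x) \<le> hnorm (direct_sum M) x" if x: "x \<in> carr (direct_sum M)" for x
  proof -
    have xk: "x k \<in> carr M" for k using x by (simp add: direct_sum_def)
    define y where "y k = q (x k)" for k
    have y: "y k \<in> carr (fock F)" "hnorm (fock F) (y k) = hnorm M (x k)" for k
      using q xk by (simp_all add: y_def)
    \<comment> \<open>By intertwining, the row applied to \<open>x\<close> is the image under the
      contraction \<open>T\<close> of the isometric row applied to the lifts.\<close>
    have "row_op R x = T (\<Sum>k\<in>UNIV. R k (y k))"
      using y by (simp add: row_op_def T.sum Rm[OF xk] y_def)
    then have "hnorm M (row_op R x) \<le> hnorm (fock F) (\<Sum>k\<in>UNIV. R k (y k))"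
      using le y by simp
    also have "\<dots> \<le> hnorm (direct_sum M) x"
    proof (rule power2_le_imp_le)
      show "(hnorm (fock F) (\<Sum>k\<in>UNIV. R k (y k)))\<^sup>2 \<le> (hnorm (direct_sum M) x)\<^sup>2"
        using F.fock_hnorm_row_R[of y] y M.hnorm_direct_sum_sq[OF x] by simp
    qed (rule M.hnorm_direct_sum_nonneg[OF x])
    finally show ?thesis .
  qed
  then have "row_contraction M R" using R_bounded by (simp add: row_contraction_def)
  with bounded R_mem show ?thesis by auto
qed

section \<open>Factorization of positive contractions\<close>

text \<open>\<open>0 \<le> A \<le> I\<close> in the sense of quadratic forms; that \<open>A\<close>
  does not increase norms follows from \<open>norm_sq_le\<close>.\<close>

locale positive_contraction = hilbert_space H for H :: "'a :: complex_vector hilb" +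
  fixes A :: "'a \<Rightarrow> 'a"
  assumes mem [simp]: "x \<in> carr H \<Longrightarrow> A x \<in> carr H"
    and add: "\<lbrakk>x \<in> carr H; y \<in> carr H\<rbrakk> \<Longrightarrow> A (x + y) = A x + A y"
    and scale: "x \<in> carr H \<Longrightarrow> A (c *\<^sub>C x) = c *\<^sub>C A x"
    and symmetric: "\<lbrakk>x \<in> carr H; y \<in> carr H\<rbrakk> \<Longrightarrow> ip H x (A y) = ip H (A x) y"
    and nonneg: "x \<in> carr H \<Longrightarrow> 0 \<le> Re (ip H x (A x))"
    and le_norm_sq: "x \<in> carr H \<Longrightarrow> Re (ip H x (A x)) \<le> (hnorm H x)\<^sup>2"
begin

text \<open>Writing \<open>A - A\<^sup>2 = A (1 - A) A + (1 - A) A (1 - A)\<close> shows that \<open>A\<^sup>2 \<le> A\<close>.\<close>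

lemma norm_sq_le:
  assumes x: "x \<in> carr H"
  shows "(hnorm H (A x))\<^sup>2 \<le> Re (ip H x (A x))"
proof -
  have "A (x - A x) = A x - A (A x)"
    using add[of "x - A x" "A x"] x by (simp add: algebra_simps)
  then have "Re (ip H (x - A x) (A x - A (A x))) \<ge> 0"
    using nonneg[of "x - A x"] x by simp
  moreover have "Re (ip H (x - A x) (A x - A (A x)))
      = Re (ip H x (A x)) - 2 * (hnorm H (A x))\<^sup>2 + Re (ip H (A x) (A (A x)))"
    using x symmetric[of x "A x"] by (simp add: ip_diff_left ip_diff_right hnorm_sq)
  moreover have "Re (ip H (A x) (A (A x))) \<le> (hnorm H (A x))\<^sup>2"
    using x by (intro le_norm_sq) simp
  ultimately show ?thesis by linarith
qed

text \<open>Allows the iteration: \<open>A - A\<^sup>2\<close> is positive because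
  \<open>A\<^sup>2 \<le> A\<close>, and it lies below \<open>A\<close>, hence below the
  identity.\<close>

lemma positive_contraction_diff_square: "positive_contraction H (\<lambda>x. A x - A (A x))"
proof
  fix x y assume x: "x \<in> carr H" and y: "y \<in> carr H"
  show "A (x + y) - A (A (x + y)) = A x - A (A x) + (A y - A (A y))"
    using x y by (simp add: add)
  have "ip H x (A (A y)) = ip H (A (A x)) y"
    using symmetric[of x "A y"] symmetric[of "A x" y] x y by simp
  then show "ip H x (A y - A (A y)) = ip H (A x - A (A x)) y"
    using symmetric[of x y] x y by (simp add: ip_diff_left ip_diff_right)
next
  fix x c assume x: "x \<in> carr H"
  show "A x - A (A x) \<in> carr H" using x by simp
  show "A (c *\<^sub>C x) - A (A (c *\<^sub>C x)) = c *\<^sub>C (A x - A (A x))"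
    using x by (simp add: scale cvec.scale_right_diff_distrib)
  have "Re (ip H x (A x - A (A x))) = Re (ip H x (A x)) - (hnorm H (A x))\<^sup>2"
    using symmetric[of x "A x"] x by (simp add: ip_diff_right hnorm_sq)
  then show "0 \<le> Re (ip H x (A x - A (A x)))" "Re (ip H x (A x - A (A x))) \<le> (hnorm H x)\<^sup>2"
    using norm_sq_le[OF x] le_norm_sq[OF x] zero_le_power2[of "hnorm H (A x)"] by linarith+
qed

end

fun deflate :: "('a :: minus \<Rightarrow> 'a) \<Rightarrow> nat \<Rightarrow> 'a \<Rightarrow> 'a" where
  "deflate A 0 = A"
| "deflate A (Suc n) = (\<lambda>x. deflate A n x - deflate A n (deflate A n x))"

context positive_contraction
begin

lemma positive_contraction_deflate: "positive_contraction H (deflate A n)"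
proof (induction n)
  case 0
  then show ?case by (simp add: positive_contraction_axioms)
next
  case (Suc n)
  then show ?case using positive_contraction.positive_contraction_diff_square by simp
qed

text \<open>Telescopes: by symmetry, the squared norm of \<open>deflate A k x\<close> is the drop of
  the quadratic form from step \<open>k\<close> to step \<open>k + 1\<close>.\<close>

lemma deflate_sum:
  assumes x: "x \<in> carr H"
  shows "(\<Sum>k<n. (hnorm H (deflate A k x))\<^sup>2) = Re (ip H x (A x)) - Re (ip H x (deflate A n x))"
proof (induction n)
  case (Suc n)
  interpret B: positive_contraction H "deflate A n" by (rule positive_contraction_deflate)
  show ?case
    using Suc B.symmetric[of x "deflate A n x"] x by (simp add: ip_diff_right hnorm_sq)
qed simp

text \<open>Positivity of the remainder bounds the partial sums, so \<open>deflate A n x\<close>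
  tends to 0 in norm; then the remainder vanishes by Cauchy-Schwarz.\<close>

lemma deflate_sums:
  assumes x: "x \<in> carr H"
  shows "(\<lambda>n. (hnorm H (deflate A n x))\<^sup>2) sums Re (ip H x (A x))"
proof -
  interpret B: positive_contraction H "deflate A n" for n by (rule positive_contraction_deflate)
  have "summable (\<lambda>n. (hnorm H (deflate A n x))\<^sup>2)"
    by (rule summableI_nonneg_bounded[of _ "Re (ip H x (A x))"])
      (use B.nonneg[OF x] in \<open>simp_all add: deflate_sum[OF x]\<close>)
  then have "(\<lambda>n. (hnorm H (deflate A n x))\<^sup>2) \<longlonglongrightarrow> 0" by (rule summable_LIMSEQ_zero)
  then have "(\<lambda>n. sqrt ((hnorm H (deflate A n x))\<^sup>2)) \<longlonglongrightarrow> sqrt 0" by (rule tendsto_real_sqrt)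
  then have lim: "(\<lambda>n. hnorm H x * hnorm H (deflate A n x)) \<longlonglongrightarrow> 0"
    using x by (intro tendsto_mult_right_zero) simp
  have "norm (Re (ip H x (deflate A n x))) \<le> hnorm H x * hnorm H (deflate A n x)" for n
    using order_trans[OF abs_Re_le_cmod cauchy_schwarz[OF x B.mem[OF x]]] by simp
  then have "(\<lambda>n. Re (ip H x (deflate A n x))) \<longlonglongrightarrow> 0"
    by (intro Lim_null_comparison[OF always_eventually lim]) simp
  then have "(\<lambda>n. Re (ip H x (A x)) - Re (ip H x (deflate A n x))) \<longlonglongrightarrow> Re (ip H x (A x)) - 0"
    by (intro tendsto_intros)
  then show ?thesis by (simp add: sums_def deflate_sum[OF x])
qed

text \<open>\<open>D\<close> collects all \<open>deflate A n x\<close> in one square-summable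
  family. Indexing by words, which are countably infinite, lets \<open>fock H\<close> serve as the
  space of sequences in \<open>H\<close>.\<close>

theorem square_root_fock:
  obtains D :: "'a \<Rightarrow> ('d :: finite list \<Rightarrow> 'a)"
  where "\<And>x. x \<in> carr H \<Longrightarrow> D x \<in> carr (fock H)"
    and "\<And>x y. \<lbrakk>x \<in> carr H; y \<in> carr H\<rbrakk> \<Longrightarrow> D (x + y) = D x + D y"
    and "\<And>c x. x \<in> carr H \<Longrightarrow> D (c *\<^sub>C x) = c *\<^sub>C D x"
    and "\<And>x. x \<in> carr H \<Longrightarrow> (hnorm (fock H) (D x))\<^sup>2 = Re (ip H x (A x))"
proof -
  interpret B: positive_contraction H "deflate A n" for n by (rule positive_contraction_deflate)
  define i where "i = to_nat_on (UNIV :: 'd list set)"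
  have i: "bij_betw i UNIV UNIV"
    unfolding i_def by (intro to_nat_on_infinite uncountable_def[THEN iffD1]) (simp_all add: infinite_UNIV_listI)
  define D where "D x = (\<lambda>\<alpha>. deflate A (i \<alpha>) x)" for x
  have sum: "((\<lambda>\<alpha>. (hnorm H (D x \<alpha>))\<^sup>2) has_sum Re (ip H x (A x))) UNIV" if "x \<in> carr H" for x
    unfolding D_def
    by (subst has_sum_reindex_bij_betw[OF i, of "\<lambda>n. (hnorm H (deflate A n x))\<^sup>2"])
      (intro sums_nonneg_imp_has_sum deflate_sums that zero_le_power2)
  show ?thesis
  proof (rule that[of D])
    fix x assume x: "x \<in> carr H"
    show mem: "D x \<in> carr (fock H)"
      using x has_sum_imp_summable[OF sum[OF x]] by (simp add: fock_carr_iff) (simp add: D_def)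
    show "(hnorm (fock H) (D x))\<^sup>2 = Re (ip H x (A x))"
      using fock_hnorm_sq[OF mem] infsumI[OF sum[OF x]] by simp
  qed (simp_all add: D_def B.add B.scale fun_eq_iff scaleC_fun_def)
qed

end

section \<open>Transport of Hilbert spaces\<close>

text \<open>The structure on the image that makes an injective linear \<Phi> unitary;
  \<open>inv \<Phi>\<close> is then a left inverse.\<close>

definition transport :: "('a \<Rightarrow> 'b) \<Rightarrow> 'a hilb \<Rightarrow> 'b hilb" where
  "transport \<Phi> G = \<lparr>carr = \<Phi> ` carr G, ip = (\<lambda>x y. ip G (inv \<Phi> x) (inv \<Phi> y))\<rparr>"

lemma hnorm_transport: "inj \<Phi> \<Longrightarrow> hnorm (transport \<Phi> G) (\<Phi> x) = hnorm G x"
  by (simp add: hnorm_def transport_def)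

lemma hilbert_space_transport:
  fixes \<Phi> :: "'a :: complex_vector \<Rightarrow> 'b :: complex_vector"
  assumes "hilbert_space G" and inj: "inj \<Phi>"
    and add: "\<And>x y. \<Phi> (x + y) = \<Phi> x + \<Phi> y" and scale: "\<And>c x. \<Phi> (c *\<^sub>C x) = c *\<^sub>C \<Phi> x"
  shows "hilbert_space (transport \<Phi> G)"
proof -
  interpret G: hilbert_space G by fact
  have zero: "\<Phi> 0 = 0" using add[of 0 0] by simp
  have diff: "\<Phi> x - \<Phi> y = \<Phi> (x - y)" for x y using add[of "x - y" y] by simp
  have carr: "carr (transport \<Phi> G) = \<Phi> ` carr G" by (simp add: transport_def)
  have ip: "ip (transport \<Phi> G) (\<Phi> x) (\<Phi> y) = ip G x y" for x y
    using inj by (simp add: transport_def)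
  show ?thesis
  proof
    show "cvec.subspace (carr (transport \<Phi> G))"
      unfolding carr
      by (rule cvec.subspaceI) (auto simp flip: zero add scale)
  next
    fix s :: "nat \<Rightarrow> 'b"
    assume "\<forall>n. s n \<in> carr (transport \<Phi> G)"
      and cauchy: "\<forall>e>0. \<exists>N. \<forall>m\<ge>N. \<forall>n\<ge>N. hnorm (transport \<Phi> G) (s m - s n) < e"
    then have "\<forall>n. \<exists>t. t \<in> carr G \<and> s n = \<Phi> t" by (auto simp: carr)
    then obtain t where t: "\<And>n. t n \<in> carr G" "\<And>n. s n = \<Phi> (t n)" by metis
    then obtain l where "l \<in> carr G" "(\<lambda>n. hnorm G (t n - l)) \<longlonglongrightarrow> 0"
      using G.complete[of t] cauchy by (auto simp: diff hnorm_transport[OF inj])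
    then show "\<exists>l\<in>carr (transport \<Phi> G). (\<lambda>n. hnorm (transport \<Phi> G) (s n - l)) \<longlonglongrightarrow> 0"
      by (auto simp: carr t diff hnorm_transport[OF inj])
  next
    fix x y z
    assume "x \<in> carr (transport \<Phi> G)" "y \<in> carr (transport \<Phi> G)" "z \<in> carr (transport \<Phi> G)"
    then obtain a b c where "a \<in> carr G" "b \<in> carr G" "c \<in> carr G" "x = \<Phi> a" "y = \<Phi> b" "z = \<Phi> c"
      unfolding carr by blast
    then show "ip (transport \<Phi> G) x (y + z) = ip (transport \<Phi> G) x y + ip (transport \<Phi> G) x z"
      by (simp add: ip G.ip_add_right flip: add)
  next
    fix x y c
    assume "x \<in> carr (transport \<Phi> G)" "y \<in> carr (transport \<Phi> G)"
    then obtain a b where *: "a \<in> carr G" "b \<in> carr G" "x = \<Phi> a" "y = \<Phi> b"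
      unfolding carr by blast
    then show "ip (transport \<Phi> G) x (c *\<^sub>C y) = c * ip (transport \<Phi> G) x y"
      by (simp add: ip G.ip_scale_right flip: scale)
    show "ip (transport \<Phi> G) y x = cnj (ip (transport \<Phi> G) x y)"
      unfolding *(3,4) ip using *(1,2) by (rule G.ip_commute)
  next
    fix x
    assume "x \<in> carr (transport \<Phi> G)"
    then obtain a where *: "a \<in> carr G" "x = \<Phi> a" unfolding carr by blast
    show "0 \<le> Re (ip (transport \<Phi> G) x x)" unfolding * ip using *(1) by (rule G.ip_nonneg)
    assume "ip (transport \<Phi> G) x x = 0"
    then have "a = 0" using *(1) unfolding * ip by (intro G.ip_definite)
    then show "x = 0" by (simp add: * zero)
  qed
qed

text \<open>The factor \<open>D\<close> takes values in \<open>fock M\<close>, which this embedding carries back into the type of the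
  elements of \<open>M\<close>.\<close>

lemma obtain_word_pairing:
  obtains \<Phi> :: "('d :: finite list \<Rightarrow> 'd list \<Rightarrow> 'j :: complex_vector) \<Rightarrow> 'd list \<Rightarrow> 'j"
  where "inj \<Phi>" "\<And>f g. \<Phi> (f + g) = \<Phi> f + \<Phi> g" "\<And>c f. \<Phi> (c *\<^sub>C f) = c *\<^sub>C \<Phi> f"
proof -
  have inf: "infinite (UNIV :: 'd list set)" by (simp add: infinite_UNIV_listI)
  then have "infinite (UNIV :: ('d list \<times> 'd list) set)" by (simp add: finite_prod)
  then have "bij_betw (from_nat_into (UNIV :: ('d list \<times> 'd list) set)) UNIV UNIV"
    by (intro bij_betw_from_nat_into) simp_all
  moreover have "bij_betw (to_nat_on (UNIV :: 'd list set)) UNIV UNIV"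
    using inf by (intro to_nat_on_infinite) simp_all
  ultimately obtain p :: "'d list \<Rightarrow> 'd list \<times> 'd list" where "bij p"
    using bij_betw_trans by blast
  then have p: "\<exists>\<beta>. p \<beta> = (a, b)" for a b by (metis bij_pointE)
  \<comment> \<open>Each word codes a pair of words, so a doubly indexed family becomes singly
    indexed; surjectivity of \<open>p\<close> makes \<Phi> injective.\<close>
  define \<Phi> :: "('d list \<Rightarrow> 'd list \<Rightarrow> 'j) \<Rightarrow> 'd list \<Rightarrow> 'j"
    where "\<Phi> f = (\<lambda>\<beta>. f (fst (p \<beta>)) (snd (p \<beta>)))" for f
  show ?thesis
  proof (rule that[of \<Phi>])
    show "inj \<Phi>"
    proof (rule injI, intro ext)
      fix f g a b assume eq: "\<Phi> f = \<Phi> g"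
      obtain \<beta> where "p \<beta> = (a, b)" using p by blast
      then show "f a b = g a b" using fun_cong[OF eq, of \<beta>] by (simp add: \<Phi>_def)
    qed
  qed (simp_all add: \<Phi>_def fun_eq_iff scaleC_fun_def)
qed

section \<open>Invariant subspaces with contractive row shift\<close>

locale row_contractive_space = J: hilbert_space J + hilbert_space M
  for J :: "'j :: complex_vector hilb" and M :: "('d :: finite list \<Rightarrow> 'j) hilb" +
  assumes carr_sub: "carr M \<subseteq> carr (fock J)"
    and bounded_embedding: "bounded_op M (fock J) (\<lambda>x. x)"
    and row_contr: "row_contraction M R"
begin

section \<open>Adjoint shifts on \<open>M\<close> and the defect operator\<close>

sublocale Rk: bounded_operator M M "R k" for k
  using row_contr hilbert_space_axioms
  by (simp add: row_contraction_def bounded_operator_def bounded_operator_axioms_def)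

text \<open>The adjoint for the inner product of \<open>M\<close>, which in general is not the
  backward shift of \<open>fock J\<close>.\<close>

abbreviation S :: "'d \<Rightarrow> ('d list \<Rightarrow> 'j) \<Rightarrow> 'd list \<Rightarrow> 'j" where
  "S k \<equiv> adj M M (R k)"

text \<open>The column of adjoints of a row contraction is contractive: testing the row on the tuple
  of the \<open>S k m\<close> bounds the squared norm of this tuple by its norm times that of
  \<open>m\<close>.\<close>

lemma sum_S_le:
  assumes m: "m \<in> carr M"
  shows "(\<Sum>k\<in>UNIV. (hnorm M (S k m))\<^sup>2) \<le> (hnorm M m)\<^sup>2"
proof -
  define y where "y k = S k m" for k
  have y: "y k \<in> carr M" for k using m by (simp add: y_def)
  then have yd: "y \<in> carr (direct_sum M)" by (simp add: direct_sum_def)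
  define n where "n = hnorm (direct_sum M) y"
  have n: "0 \<le> n" "n\<^sup>2 = (\<Sum>k\<in>UNIV. (hnorm M (y k))\<^sup>2)"
    using hnorm_direct_sum_nonneg[OF yd] hnorm_direct_sum_sq[OF yd] by (simp_all add: n_def)
  have row: "row_op R y \<in> carr M" using y by (simp add: row_op_def sum_carr)
  have "n\<^sup>2 = Re (ip M m (row_op R y))"
    using y m by (simp add: n row_op_def ip_sum_right hnorm_sq y_def Rk.adj_ip flip: Rk.adj_ip)
  also have "\<dots> \<le> hnorm M m * hnorm M (row_op R y)"
    using order_trans[OF complex_Re_le_cmod cauchy_schwarz[OF m row]] .
  also have "\<dots> \<le> hnorm M m * n"
    using row_contr yd m by (intro mult_left_mono) (simp_all add: row_contraction_def n_def)
  finally have "n * n \<le> hnorm M m * n" by (simp add: power2_eq_square)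
  then have "n \<le> hnorm M m"
    using n(1) hnorm_nonneg[OF m] by (cases "n = 0") simp_all
  then have "n\<^sup>2 \<le> (hnorm M m)\<^sup>2" using n(1) by (rule power_mono)
  then show ?thesis unfolding n(2) y_def .
qed

definition \<Delta> :: "('d list \<Rightarrow> 'j) \<Rightarrow> 'd list \<Rightarrow> 'j" where
  "\<Delta> m = m - (\<Sum>k\<in>UNIV. R k (S k m))"

lemma ip_defect:
  assumes "x \<in> carr M" "y \<in> carr M"
  shows "ip M x (\<Delta> y) = ip M x y - (\<Sum>k\<in>UNIV. ip M (S k x) (S k y))"
  using assms by (simp add: \<Delta>_def ip_diff_right ip_sum_right Rk.adj_ip)

lemma Re_ip_defect:
  "m \<in> carr M \<Longrightarrow> Re (ip M m (\<Delta> m)) = (hnorm M m)\<^sup>2 - (\<Sum>k\<in>UNIV. (hnorm M (S k m))\<^sup>2)"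
  by (simp add: ip_defect hnorm_sq)

text \<open>Positivity is \<open>sum_S_le\<close>; the upper bound holds because a sum of squared
  norms is subtracted.\<close>

sublocale defect: positive_contraction M \<Delta>
proof
  fix x y assume x: "x \<in> carr M" and y: "y \<in> carr M"
  show "\<Delta> x \<in> carr M" using x by (simp add: \<Delta>_def sum_carr)
  show "\<Delta> (x + y) = \<Delta> x + \<Delta> y"
    using x y by (simp add: \<Delta>_def Rk.adj_add R_add sum.distrib)
  have "\<Delta> y \<in> carr M" "\<Delta> x \<in> carr M" using x y by (simp_all add: \<Delta>_def sum_carr)
  then have "ip M (\<Delta> x) y = cnj (ip M y (\<Delta> x))" using y by (intro ip_commute)
  also have "\<dots> = cnj (ip M y x) - (\<Sum>k\<in>UNIV. cnj (ip M (S k y) (S k x)))"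
    using x y by (simp add: ip_defect)
  also have "\<dots> = ip M x (\<Delta> y)"
    using x y ip_commute[OF y x] ip_commute[OF Rk.adj_carr Rk.adj_carr, OF y x]
    by (simp add: ip_defect)
  finally show "ip M x (\<Delta> y) = ip M (\<Delta> x) y" by simp
next
  fix x c assume x: "x \<in> carr M"
  show "\<Delta> (c *\<^sub>C x) = c *\<^sub>C \<Delta> x"
    using x by (simp add: \<Delta>_def Rk.adj_scale R_scale cvec.scale_right_diff_distrib cvec.scale_sum_right)
  show "0 \<le> Re (ip M x (\<Delta> x))" "Re (ip M x (\<Delta> x)) \<le> (hnorm M x)\<^sup>2"
    using sum_S_le[OF x] by (simp_all add: Re_ip_defect[OF x] sum_nonneg)
qed

section \<open>Iterated adjoint shifts, coefficient kernels and purity\<close>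

definition W :: "'d list \<Rightarrow> ('d list \<Rightarrow> 'j) \<Rightarrow> 'd list \<Rightarrow> 'j" where
  "W \<alpha> = foldr S \<alpha>"

text \<open>The last rule peels off the letter that a right shift appends; the intertwining relation
  of \<open>V\<close> rests on it.\<close>

lemma W_simps [simp]: "W [] m = m" "W (k # \<alpha>) m = S k (W \<alpha> m)" "W (\<alpha> @ [k]) m = W \<alpha> (S k m)"
  by (simp_all add: W_def)

lemma W_carr [simp]: "m \<in> carr M \<Longrightarrow> W \<alpha> m \<in> carr M"
  by (induction \<alpha>) simp_all

lemma W_add: "\<lbrakk>x \<in> carr M; y \<in> carr M\<rbrakk> \<Longrightarrow> W \<alpha> (x + y) = W \<alpha> x + W \<alpha> y"
  by (induction \<alpha>) (simp_all add: Rk.adj_add)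

lemma W_scale: "x \<in> carr M \<Longrightarrow> W \<alpha> (c *\<^sub>C x) = c *\<^sub>C W \<alpha> x"
  by (induction \<alpha>) (simp_all add: Rk.adj_scale)

text \<open>What is left of the squared norm after \<open>n\<close> adjoint shifts; purity means
  that it tends to 0.\<close>

definition energy :: "nat \<Rightarrow> ('d list \<Rightarrow> 'j) \<Rightarrow> real" where
  "energy n m = (\<Sum>\<alpha> | length \<alpha> = n. (hnorm M (W \<alpha> m))\<^sup>2)"

lemma finite_words [simp]:
  shows "finite {\<alpha> :: 'd list. length \<alpha> = n}" and "finite {\<alpha> :: 'd list. length \<alpha> < n}"
  using finite_lists_length_eq[of "UNIV :: 'd set" n] finite_lists_length_le[of "UNIV :: 'd set" n]
  by (auto elim: rev_finite_subset)

lemma energy_0 [simp]: "energy 0 m = (hnorm M m)\<^sup>2"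
  by (simp add: energy_def)

lemma energy_nonneg: "0 \<le> energy n m"
  by (simp add: energy_def sum_nonneg)

text \<open>Splitting off the first letter, the one applied last, brings the inner sum into the form
  of \<open>sum_S_le\<close>.\<close>

lemma energy_Suc:
  "energy (Suc n) m = (\<Sum>\<alpha> | length \<alpha> = n. \<Sum>k\<in>UNIV. (hnorm M (S k (W \<alpha> m)))\<^sup>2)"
proof -
  have words: "{\<alpha> :: 'd list. length \<alpha> = Suc n} = (\<lambda>(\<alpha>, k). k # \<alpha>) ` ({\<alpha>. length \<alpha> = n} \<times> UNIV)"
    by (auto simp: length_Suc_conv image_iff)
  have inj: "inj_on (\<lambda>(\<alpha> :: 'd list, k). k # \<alpha>) ({\<alpha>. length \<alpha> = n} \<times> UNIV)"
    by (auto simp: inj_on_def)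
  show ?thesis
    unfolding energy_def words sum.reindex[OF inj] sum.cartesian_product
    by (simp add: case_prod_unfold)
qed

lemma energy_Suc_le: "m \<in> carr M \<Longrightarrow> energy (Suc n) m \<le> energy n m"
  unfolding energy_Suc by (subst energy_def) (intro sum_mono sum_S_le, simp)

lemma energy_antimono: "\<lbrakk>m \<in> carr M; n \<le> n'\<rbrakk> \<Longrightarrow> energy n' m \<le> energy n m"
  by (rule lift_Suc_antimono_le[of "\<lambda>n. energy n m"]) (simp_all add: energy_Suc_le)

lemma energy_le: "m \<in> carr M \<Longrightarrow> energy n m \<le> (hnorm M m)\<^sup>2"
  using energy_antimono[of m 0 n] by simp

lemma energy_scale: "m \<in> carr M \<Longrightarrow> energy n (c *\<^sub>C m) = (cmod c)\<^sup>2 * energy n m"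
  by (simp add: energy_def W_scale hnorm_scale power_mult_distrib sum_distrib_left)

text \<open>Parallelogram law for each word; the factor 2 is harmless for convergence to 0.\<close>

lemma energy_add:
  assumes "x \<in> carr M" "y \<in> carr M"
  shows "energy n (x + y) \<le> 2 * energy n x + 2 * energy n y"
proof -
  have "(hnorm M (W \<alpha> (x + y)))\<^sup>2 \<le> 2 * (hnorm M (W \<alpha> x))\<^sup>2 + 2 * (hnorm M (W \<alpha> y))\<^sup>2" for \<alpha>
    using parallelogram[OF W_carr W_carr, OF assms, of \<alpha> \<alpha>]
      zero_le_power2[of "hnorm M (W \<alpha> x - W \<alpha> y)"] unfolding W_add[OF assms] by linarith
  then show ?thesis
    unfolding energy_def sum_distrib_left sum.distrib[symmetric] by (intro sum_mono)
qed

text \<open>Reproducing kernel vectors of \<open>M\<close>. Nilpotency is governed by the length of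
  the word alone, so the word and the vector of \<open>J\<close> are hidden in the
  quantifier.\<close>

definition coefficient_kernel :: "nat \<Rightarrow> ('d list \<Rightarrow> 'j) \<Rightarrow> bool" where
  "coefficient_kernel n K \<longleftrightarrow> K \<in> carr M \<and>
    (\<exists>\<gamma> j. length \<gamma> = n \<and> j \<in> carr J \<and> (\<forall>m\<in>carr M. ip M K m = ip J j (m \<gamma>)))"

text \<open>Riesz representation in \<open>M\<close>: coefficients are bounded by the norm of
  \<open>fock J\<close>, and the embedding is bounded.\<close>

lemma coefficient_kernel_exists:
  assumes j: "j \<in> carr J"
  obtains K where "coefficient_kernel (length \<gamma>) K" "\<And>m. m \<in> carr M \<Longrightarrow> ip M K m = ip J j (m \<gamma>)"
proof -
  have mem: "m \<in> carr M \<Longrightarrow> m \<alpha> \<in> carr J" for m \<alpha> using carr_sub by auto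
  have "\<exists>C. \<forall>m\<in>carr M. hnorm (fock J) m \<le> C * hnorm M m"
    using bounded_embedding by (simp add: bounded_op_def)
  then obtain C where C: "\<And>m. m \<in> carr M \<Longrightarrow> hnorm (fock J) m \<le> C * hnorm M m" by blast
  have "cmod (ip J j (m \<gamma>)) \<le> (hnorm J j * C) * hnorm M m" if m: "m \<in> carr M" for m
  proof -
    have "hnorm J (m \<gamma>) \<le> C * hnorm M m"
      using J.fock_hnorm_nth_le[of m \<gamma>] C[OF m] carr_sub m by force
    then have "hnorm J j * hnorm J (m \<gamma>) \<le> hnorm J j * (C * hnorm M m)"
      using j by (intro mult_left_mono) simp_all
    then show ?thesis using J.cauchy_schwarz[OF j mem[OF m], of \<gamma>] by (simp add: mult.assoc)
  qed
  then obtain K where "K \<in> carr M" "\<And>m. m \<in> carr M \<Longrightarrow> ip M K m = ip J j (m \<gamma>)"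
    using riesz_representation[of "\<lambda>m. ip J j (m \<gamma>)" "hnorm J j * C"] j mem
    by (auto simp: J.ip_add_right J.ip_scale_right scaleC_fun_def)
  then show ?thesis using j by (intro that[of K]) (auto simp: coefficient_kernel_def)
qed

text \<open>\<open>S k\<close> composes the functional with \<open>R k\<close>. The result reads the
  coefficient at \<gamma> without its last letter if that letter is \<open>k\<close>, and vanishes
  otherwise.\<close>

lemma S_coefficient_kernel:
  assumes "coefficient_kernel n K"
  shows "S k K = 0 \<or> (\<exists>n'. Suc n' = n \<and> coefficient_kernel n' (S k K))"
proof -
  obtain \<gamma> j where K: "K \<in> carr M" "length \<gamma> = n" "j \<in> carr J"
      "\<And>m. m \<in> carr M \<Longrightarrow> ip M K m = ip J j (m \<gamma>)"
    using assms unfolding coefficient_kernel_def by blast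
  have SK: "ip M (S k K) m = ip J j (R k m \<gamma>)" if "m \<in> carr M" for m
    using K that by (simp add: Rk.adj_ip)
  show ?thesis
  proof (cases "\<gamma> \<noteq> [] \<and> last \<gamma> = k")
    case True
    then have "coefficient_kernel (length (butlast \<gamma>)) (S k K)"
      unfolding coefficient_kernel_def using SK K by (auto simp: R_def simp del: length_butlast)
    then show ?thesis using True K(2) by (intro disjI2 exI[of _ "length (butlast \<gamma>)"]) auto
  next
    case False
    then have "S k K = 0"
      using SK K by (intro eq_if_ip_eq) (auto simp: R_def)
    then show ?thesis by simp
  qed
qed

text \<open>Each adjoint shift shortens the word by one letter or gives 0, so more than
  \<open>n\<close> of them give 0.\<close>

lemma energy_coefficient_kernel:
  assumes K: "coefficient_kernel n K" and n': "n < n'"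
  shows "energy n' K = 0"
proof -
  have "W \<alpha> K = 0 \<or> (\<exists>l. l + length \<alpha> = n \<and> coefficient_kernel l (W \<alpha> K))" for \<alpha>
  proof (induction \<alpha>)
    case (Cons k \<alpha>)
    show ?case
    proof (cases "W \<alpha> K = 0")
      case False
      then obtain l where "l + length \<alpha> = n" "coefficient_kernel l (W \<alpha> K)" using Cons by blast
      then show ?thesis using S_coefficient_kernel[of l "W \<alpha> K" k] by auto
    qed simp
  qed (use K in simp)
  then have "W \<alpha> K = 0" if "length \<alpha> = n'" for \<alpha>
    using that n' by (metis le_add2 leD)
  then show ?thesis by (simp add: energy_def)
qed

text \<open>Purity of the row contraction. The coefficient functionals are represented by vectors on which
  the adjoint shifts are nilpotent, and these vectors have trivial orthogonal complement.\<close>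

theorem energy_tendsto_0:
  assumes m: "m \<in> carr M"
  shows "(\<lambda>n. energy n m) \<longlonglongrightarrow> 0"
proof -
  define N where "N = {m \<in> carr M. (\<lambda>n. energy n m) \<longlonglongrightarrow> 0}"
  have sub: "N \<subseteq> carr M" by (auto simp: N_def)
  have addN: "x + y \<in> N" if "x \<in> N" "y \<in> N" for x y
  proof -
    have "(\<lambda>n. 2 * energy n x + 2 * energy n y) \<longlonglongrightarrow> 2 * 0 + 2 * 0"
      using that by (intro tendsto_intros) (simp_all add: N_def)
    then have lim: "(\<lambda>n. 2 * energy n x + 2 * energy n y) \<longlonglongrightarrow> 0" by simp
    have "(\<lambda>n. energy n (x + y)) \<longlonglongrightarrow> 0"
      using energy_add[of x y] that
      by (intro Lim_null_comparison[OF always_eventually lim]) (simp add: N_def energy_nonneg)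
    then show ?thesis using that by (simp add: N_def)
  qed
  have "energy n 0 = 0" for n using energy_scale[of 0 n 0] by simp
  then have subspace: "cvec.subspace N"
    by (intro cvec.subspaceI addN)
      (auto simp: N_def energy_scale intro: tendsto_mult_right_zero)
  have "seq_closed N"
    unfolding seq_closed_def
  proof (intro allI impI)
    fix x l assume x: "\<forall>n. x n \<in> N" and l: "l \<in> carr M" and lim: "(\<lambda>n. hnorm M (x n - l)) \<longlonglongrightarrow> 0"
    have "(\<lambda>n. energy n l) \<longlonglongrightarrow> 0"
    proof (rule LIMSEQ_I)
      fix e :: real assume e: "0 < e"
      \<comment> \<open>\<open>energy_add\<close> doubles both terms, so each may be at most
        \<open>e / 4\<close>.\<close>
      have "\<forall>\<^sub>F i in sequentially. hnorm M (x i - l) < sqrt (e / 4)"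
        using e by (intro order_tendstoD(2)[OF lim] real_sqrt_gt_zero) simp
      then obtain i where i: "hnorm M (x i - l) < sqrt (e / 4)"
        using eventually_happens' sequentially_bot by blast
      have xi: "x i \<in> carr M" "(\<lambda>n. energy n (x i)) \<longlonglongrightarrow> 0" using x by (auto simp: N_def)
      have "(hnorm M (l - x i))\<^sup>2 < (sqrt (e / 4))\<^sup>2"
        using i hnorm_diff_commute[OF l xi(1)] l xi by (intro power_strict_mono) simp_all
      then have small: "(hnorm M (l - x i))\<^sup>2 < e / 4" using e by simp
      have "\<forall>\<^sub>F n in sequentially. energy n (x i) < e / 4"
        using e by (intro order_tendstoD(2)[OF xi(2)]) simp
      then obtain n0 where n0: "\<And>n. n \<ge> n0 \<Longrightarrow> energy n (x i) < e / 4"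
        by (auto simp: eventually_sequentially)
      have "energy n l < e" if "n \<ge> n0" for n
      proof -
        have "energy n l \<le> 2 * energy n (x i) + 2 * energy n (l - x i)"
          using energy_add[of "x i" "l - x i" n] xi l by simp
        moreover have "energy n (l - x i) \<le> (hnorm M (l - x i))\<^sup>2"
          using xi l by (intro energy_le) simp
        ultimately show ?thesis using n0[OF that] small by linarith
      qed
      then show "\<exists>n0. \<forall>n\<ge>n0. norm (energy n l - 0) < e"
        by (intro exI[of _ n0]) (simp add: energy_nonneg)
    qed
    then show "l \<in> N" using l by (simp add: N_def)
  qed
  then obtain p where p: "p \<in> N" "m - p \<in> ortho M N"
    using projection_theorem subspace sub m by blast
  define w where "w = m - p"
  have w: "w \<in> carr M" using p m sub by (auto simp: w_def)
  have wJ: "w \<gamma> \<in> carr J" for \<gamma> using w carr_sub by auto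
  have "w \<gamma> = 0" for \<gamma>
  proof -
    \<comment> \<open>With \<open>w \<gamma>\<close> as the vector of \<open>J\<close>, pairing
      \<open>K\<close> with \<open>w\<close> gives the squared norm of \<open>w \<gamma>\<close>;
      the pairing is 0 because \<open>K\<close> lies in \<open>N\<close>.\<close>
    obtain K where K: "coefficient_kernel (length \<gamma>) K"
        "\<And>m. m \<in> carr M \<Longrightarrow> ip M K m = ip J (w \<gamma>) (m \<gamma>)"
      using coefficient_kernel_exists[OF wJ] by blast
    have "\<forall>\<^sub>F n in sequentially. energy n K = 0"
      using eventually_gt_at_top[of "length \<gamma>"] by eventually_elim (rule energy_coefficient_kernel[OF K(1)])
    then have "(\<lambda>n. energy n K) \<longlonglongrightarrow> 0" by (rule tendsto_eventually)
    then have "K \<in> N" using K(1) by (simp add: N_def coefficient_kernel_def)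
    then have "ip M K w = 0" using p by (simp add: ortho_def w_def)
    then show ?thesis using K(2)[OF w] J.ip_definite[OF wJ] by simp
  qed
  then have "m = p" by (simp add: w_def fun_eq_iff)
  then show ?thesis using p by (simp add: N_def)
qed

end

section \<open>Construction of the multiplier\<close>

context row_contractive_space
begin

text \<open>Telescopes: by the formula for the defect, the words of length \<open>n\<close>
  contribute \<open>energy n m - energy (Suc n) m\<close>.\<close>

lemma sum_defect_norms:
  fixes F :: "'f :: complex_vector hilb"
  assumes D: "\<And>x. x \<in> carr M \<Longrightarrow> (hnorm F (D x))\<^sup>2 = Re (ip M x (\<Delta> x))" and m: "m \<in> carr M"
  shows "(\<Sum>\<alpha> | length \<alpha> < n. (hnorm F (D (W \<alpha> m)))\<^sup>2) = (hnorm M m)\<^sup>2 - energy n m"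
proof (induction n)
  case (Suc n)
  have "{\<alpha> :: 'd list. length \<alpha> < Suc n} = {\<alpha>. length \<alpha> < n} \<union> {\<alpha>. length \<alpha> = n}" by auto
  then have "(\<Sum>\<alpha> | length \<alpha> < Suc n. (hnorm F (D (W \<alpha> m)))\<^sup>2)
      = (hnorm M m)\<^sup>2 - energy n m + (\<Sum>\<alpha> | length \<alpha> = n. (hnorm F (D (W \<alpha> m)))\<^sup>2)"
    using Suc by (simp only:) (subst sum.union_disjoint, auto)
  also have "(\<Sum>\<alpha> | length \<alpha> = n. (hnorm F (D (W \<alpha> m)))\<^sup>2) = energy n m - energy (Suc n) m"
    using m by (simp add: D Re_ip_defect sum_subtractf energy_Suc energy_def[of n])
  finally show ?case by simp
qed simp

theorem realizes_exists:
  obtains F :: "('d list \<Rightarrow> 'j) hilb" and T where "realizes J M F T"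
proof -
  obtain D0 :: "('d list \<Rightarrow> 'j) \<Rightarrow> 'd list \<Rightarrow> 'd list \<Rightarrow> 'j" where D0:
      "\<And>x. x \<in> carr M \<Longrightarrow> D0 x \<in> carr (fock M)"
      "\<And>x y. \<lbrakk>x \<in> carr M; y \<in> carr M\<rbrakk> \<Longrightarrow> D0 (x + y) = D0 x + D0 y"
      "\<And>c x. x \<in> carr M \<Longrightarrow> D0 (c *\<^sub>C x) = c *\<^sub>C D0 x"
      "\<And>x. x \<in> carr M \<Longrightarrow> (hnorm (fock M) (D0 x))\<^sup>2 = Re (ip M x (\<Delta> x))"
    using defect.square_root_fock[where 'd = 'd] by blast
  obtain \<Phi> :: "('d list \<Rightarrow> 'd list \<Rightarrow> 'j) \<Rightarrow> 'd list \<Rightarrow> 'j" where \<Phi>: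
      "inj \<Phi>" "\<And>f g. \<Phi> (f + g) = \<Phi> f + \<Phi> g" "\<And>c f. \<Phi> (c *\<^sub>C f) = c *\<^sub>C \<Phi> f"
    using obtain_word_pairing by blast
  define F where "F = transport \<Phi> (fock M)"
  define D where "D x = \<Phi> (D0 x)" for x
  interpret F: hilbert_space F
    unfolding F_def by (intro hilbert_space_transport hilbert_space_fock \<Phi>)
  interpret FF: hilbert_space "fock F :: ('d list \<Rightarrow> 'd list \<Rightarrow> 'j) hilb" by (rule F.hilbert_space_fock)
  interpret FJ: hilbert_space "fock J :: ('d list \<Rightarrow> 'j) hilb" by (rule J.hilbert_space_fock)
  have D_carr: "D x \<in> carr F" if "x \<in> carr M" for x
    using D0(1)[OF that] by (simp add: D_def F_def transport_def)
  have D_norm: "(hnorm F (D x))\<^sup>2 = Re (ip M x (\<Delta> x))" if "x \<in> carr M" for x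
    using D0(4)[OF that] by (simp add: D_def F_def hnorm_transport[OF \<Phi>(1)])
  define V where "V m = (\<lambda>\<alpha>. D (W \<alpha> m))" for m
  have partial: "(\<Sum>\<alpha> | length \<alpha> < n. (hnorm F (V m \<alpha>))\<^sup>2) = (hnorm M m)\<^sup>2 - energy n m"
    if "m \<in> carr M" for n m
    unfolding V_def using sum_defect_norms[OF D_norm that] .
  have bound: "(\<Sum>\<alpha>\<in>A. (hnorm F (V m \<alpha>))\<^sup>2) \<le> (hnorm M m)\<^sup>2" if m: "m \<in> carr M" and A: "finite A" for A m
  proof -
    obtain n where n: "\<And>\<alpha>. \<alpha> \<in> A \<Longrightarrow> length \<alpha> < n"
      using A finite_nat_set_iff_bounded[of "length ` A"] by auto
    have "(\<Sum>\<alpha>\<in>A. (hnorm F (V m \<alpha>))\<^sup>2) \<le> (\<Sum>\<alpha> | length \<alpha> < n. (hnorm F (V m \<alpha>))\<^sup>2)"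
      using n by (intro sum_mono2) auto
    then show ?thesis using partial[OF m, of n] energy_nonneg[of n m] by linarith
  qed
  have V_carr: "V m \<in> carr (fock F)" if m: "m \<in> carr M" for m
    using F.fock_carr_bounded_partial_sums[OF _ bound[OF m]] m D_carr by (simp add: V_def)
  have V_norm: "hnorm (fock F) (V m) = hnorm M m" if m: "m \<in> carr M" for m
  proof (rule antisym)
    show "hnorm (fock F) (V m) \<le> hnorm M m"
      using F.hnorm_le_if_partial_sums_le[OF V_carr[OF m] bound[OF m]] m by simp
    \<comment> \<open>Purity enters here: the missing energy vanishes in the limit, so
      \<open>V\<close> loses no norm.\<close>
    have "(hnorm M m)\<^sup>2 - energy n m \<le> (hnorm (fock F) (V m))\<^sup>2" for n
      using F.fock_partial_sum_le[OF V_carr[OF m] finite_words(2)[of n]] partial[OF m, of n] by simp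
    moreover have "(\<lambda>n. (hnorm M m)\<^sup>2 - energy n m) \<longlonglongrightarrow> (hnorm M m)\<^sup>2 - 0"
      by (intro tendsto_intros energy_tendsto_0 m)
    ultimately have "(hnorm M m)\<^sup>2 \<le> (hnorm (fock F) (V m))\<^sup>2"
      by (intro LIMSEQ_le_const2[of _ "(hnorm M m)\<^sup>2"]) auto
    then show "hnorm M m \<le> hnorm (fock F) (V m)"
      using FF.hnorm_nonneg[OF V_carr[OF m]] by (rule power2_le_imp_le)
  qed
  \<comment> \<open>The backward shift of \<open>V m\<close> is \<open>V (S k m)\<close>; taking
    adjoints yields the commutation of \<open>T\<close> with right shifts.\<close>
  have V_shift: "V m (\<alpha> @ [k]) = V (S k m) \<alpha>" for m \<alpha> k by (simp add: V_def)
  have V_add: "V (x + y) = V x + V y" if "x \<in> carr M" "y \<in> carr M" for x y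
    using that by (intro ext[of "V (x + y)"]) (simp add: V_def W_add D_def D0 \<Phi>)
  have "D (W \<alpha> (c *\<^sub>C x)) = c *\<^sub>C D (W \<alpha> x)" if "x \<in> carr M" for c x \<alpha>
    using that by (simp add: W_scale D_def D0 \<Phi>)
  then have V_scale: "V (c *\<^sub>C x) = c *\<^sub>C V x" if "x \<in> carr M" for c x
    using that by (simp add: V_def scaleC_fun_def[of c "\<lambda>\<alpha>. D (W \<alpha> x)"])
  interpret V: bounded_operator M "fock F" V
  proof
    show "bounded_op M (fock F) V"
      unfolding bounded_op_def
      using V_carr V_norm V_add V_scale by (auto intro!: exI[of _ 1])
  qed
  \<comment> \<open>The adjoint is taken in the norm of \<open>M\<close>; its values are already
    elements of \<open>fock J\<close>, so no embedding has to be written.\<close>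
  define T where "T = adj M (fock F) V"
  have T_carr: "T f \<in> carr M" if "f \<in> carr (fock F)" for f
    using that by (simp add: T_def)
  have T_le: "hnorm M (T f) \<le> hnorm (fock F) f" if "f \<in> carr (fock F)" for f
    using V.adj_bound[of 1 f] V_norm that by (simp add: T_def)
  \<comment> \<open>Instead of polarizing, the square of the norm of \<open>T (V m) - m\<close> is
    expanded; contractivity of \<open>T\<close> and isometry of \<open>V\<close> make it at most
    0.\<close>
  have TV: "T (V m) = m" if m: "m \<in> carr M" for m
  proof -
    have mem: "T (V m) \<in> carr M" "V m \<in> carr (fock F)" using m V_carr T_carr by simp_all
    have "Re (ip M (T (V m)) m) = (hnorm M m)\<^sup>2"
      using m mem V_norm[OF m] by (simp add: T_def V.adj_ip FF.hnorm_sq[symmetric])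
    moreover have "(hnorm M (T (V m)))\<^sup>2 \<le> (hnorm M m)\<^sup>2"
      using T_le[OF mem(2)] V_norm[OF m] hnorm_nonneg[OF mem(1)] by (intro power_mono) simp_all
    ultimately have "(hnorm M (T (V m) - m))\<^sup>2 \<le> 0"
      using hnorm_diff_sq[OF mem(1) m] by linarith
    then have "hnorm M (T (V m) - m) = 0" by simp
    then show ?thesis using mem m hnorm_eq_0_iff[of "T (V m) - m"] by simp
  qed
  have TR: "T (R k f) = R k (T f)" if f: "f \<in> carr (fock F)" for k f
  proof (rule eq_if_ip_eq)
    show mem: "T (R k f) \<in> carr M" "R k (T f) \<in> carr M" using f T_carr by simp_all
    fix m assume m: "m \<in> carr M"
    have "ip M m (T (R k f)) = ip (fock F) (V m) (R k f)"
      using m f by (simp add: T_def V.adj_ip_right)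
    also have "\<dots> = ip (fock F) (\<lambda>\<alpha>. V m (\<alpha> @ [k])) f"
      using V_carr[OF m] by (intro F.fock_ip_R_right) simp
    also have "\<dots> = ip (fock F) (V (S k m)) f" by (simp add: V_shift)
    also have "\<dots> = ip M (S k m) (T f)" using m f by (simp add: T_def V.adj_ip_right)
    also have "\<dots> = ip M m (R k (T f))" using m f T_carr by (simp add: Rk.adj_ip)
    finally show "ip M (T (R k f)) m = ip M (R k (T f)) m"
      using ip_commute[OF m mem(1)] ip_commute[OF m mem(2)] by simp
  qed
  obtain C where "C > 0" and C: "\<And>m. m \<in> carr M \<Longrightarrow> hnorm (fock J) m \<le> C * hnorm M m"
  proof -
    interpret E: bounded_operator M "fock J" "\<lambda>x. x"
      by unfold_locales (rule bounded_embedding)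
    show ?thesis using E.bound that by blast
  qed
  have "hnorm (fock J) (T f) \<le> C * hnorm (fock F) f" if f: "f \<in> carr (fock F)" for f
    using C[OF T_carr[OF f]] mult_left_mono[OF T_le[OF f], of C] \<open>C > 0\<close> by linarith
  then have multiplier: "left_multiplier F J T"
    using T_carr carr_sub TR
    by (auto simp: left_multiplier_def bounded_op_def T_def V.adj_add V.adj_scale)
  have surj: "carr M = T ` carr (fock F)"
  proof (intro equalityI subsetI)
    fix m assume "m \<in> carr M"
    then show "m \<in> T ` carr (fock F)" using TV V_carr by (intro image_eqI[of m T "V m"]) simp_all
  qed (use T_carr in auto)
  \<comment> \<open>\<open>f - V (T f)\<close> is killed by \<open>T\<close> since
    \<open>T V\<close> is the identity, and the range of \<open>V\<close> is orthogonal to the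
    kernel of its adjoint \<open>T\<close>.\<close>
  have "proj (fock F) (ortho (fock F) (ker_op (fock F) T)) f = V (T f)" if f: "f \<in> carr (fock F)" for f
  proof -
    have mem: "V (T f) \<in> carr (fock F)" "T f \<in> carr M" using f T_carr V_carr by simp_all
    have "T (f - V (T f)) = T f - T (V (T f))"
      unfolding T_def by (rule V.adj_diff) (use f mem in \<open>simp_all add: T_def\<close>)
    then have k: "f - V (T f) \<in> ker_op (fock F) T"
      using f mem TV[OF mem(2)] by (simp add: ker_op_def)
    have "ip (fock F) y (V (T f)) = 0" if "y \<in> ker_op (fock F) T" for y
      using that mem V.adj_ip[of "T f" y] by (simp add: ker_op_def T_def)
    then have q: "V (T f) \<in> ortho (fock F) (ker_op (fock F) T)"
      using mem by (simp add: ortho_def)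
    show ?thesis using FF.proj_ortho_eq[OF _ k q] by (simp add: ker_op_def)
  qed
  then have range: "is_operator_range M (fock F) T"
    using surj V_norm T_carr by (simp add: is_operator_range_def)
  \<comment> \<open>\<open>V\<close> lifts the unit ball of \<open>M\<close> and \<open>T\<close> is
    contractive, so both operator norms are suprema over the same vectors.\<close>
  have "{m \<in> carr M. hnorm M m \<le> 1} = T ` {f \<in> carr (fock F). hnorm (fock F) f \<le> 1}"
  proof (intro equalityI subsetI)
    fix m assume "m \<in> {m \<in> carr M. hnorm M m \<le> 1}"
    then show "m \<in> T ` {f \<in> carr (fock F). hnorm (fock F) f \<le> 1}"
      using V_carr V_norm TV by (intro image_eqI[of _ _ "V m"]) simp_all
  next
    fix m assume "m \<in> T ` {f \<in> carr (fock F). hnorm (fock F) f \<le> 1}"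
    then show "m \<in> {m \<in> carr M. hnorm M m \<le> 1}"
      using T_carr T_le by (auto intro: order_trans)
  qed
  then have "opnorm (fock F) (fock J) T = opnorm M (fock J) (\<lambda>x. x)"
    by (simp add: opnorm_def image_image)
  then show ?thesis
    using that F.hilbert_space_axioms multiplier range by (simp add: realizes_def)
qed

end

(* An existential quantifier over Hilbert spaces F must fix the ambient type of F. The first
   conjunct is the equivalence with F inside the type of elements of fock J; the second conjunct
   is the "if" direction for F in an arbitrary type 'f. Together they give the equivalence for
   Hilbert spaces F of any size. *)
theorem theorem4p2:
  fixes J :: "'j :: complex_vector hilb"
    and M :: "('d :: finite list \<Rightarrow> 'j) hilb"
  assumes "hilbert_space J"
    and "hilbert_space M"
    and "carr M \<subseteq> carr (fock J)"
  shows "(bounded_op M (fock J) (\<lambda>x. x) \<and> (\<forall>k. R k ` carr M \<subseteq> carr M) \<and> row_contraction M R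
            \<longleftrightarrow> (\<exists>(F :: ('d list \<Rightarrow> 'j) hilb) T. realizes J M F T)) \<and>
         ((\<exists>(F :: 'f :: complex_vector hilb) T. realizes J M F T) \<longrightarrow>
            bounded_op M (fock J) (\<lambda>x. x) \<and> (\<forall>k. R k ` carr M \<subseteq> carr M) \<and> row_contraction M R)"
proof (intro conjI impI iffI; (elim exE)?)
  assume "bounded_op M (fock J) (\<lambda>x. x) \<and> (\<forall>k. R k ` carr M \<subseteq> carr M) \<and> row_contraction M R"
  then interpret row_contractive_space J M
    using assms by (simp add: row_contractive_space_def row_contractive_space_axioms_def)
  show "\<exists>(F :: ('d list \<Rightarrow> 'j) hilb) T. realizes J M F T" using realizes_exists by blast
\<comment> \<open>The two remaining goals are the same implication for two types of
  \<open>F\<close>.\<close>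
qed (use row_contraction_if_realizes[OF assms(1,2)] in blast)+

end
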